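(* Let $n\in\mathbb{N}$, $n\geq2$. Let $Y$ be a compact manifold of class $C^1$ that is imbedded in $\mathbb{R}^n$, of dimension $n-1$. Let $s_1\in[0,n-1[$. Let $\beta\in]0,1]$, $t_1\in[\beta,(n-1)+\beta[$, $t_2\in[\beta,+\infty[$, $t_3\in]0,1]$. Let the kernel $K\in\mathcal{K}_{s_1,s_1+1,1}(Y\times Y)$ satisfy \[ K(\cdot,y)\in C^1(Y\setminus\{y\})\qquad\forall y\in Y . \] Let $t_1=n-1$, $\mathrm{grad}_{Y,x}K(\cdot,\cdot)\in\left(\mathcal{K}_{t_1,t_2,t_3}(Y\times Y)\right)^n$, $t_2-\beta>n-1$ and $t_2\leq(n-1)+t_3$. If the map from $C^{0,\beta}(Y)$ to $C^{1,\beta}(Y)$ that takes $\mu$ to the function $\int_YK(\cdot,y)\mu(y)\,d\sigma_y$ is linear and continuous, then \[ \sup_{x\in Y}\ \sup_{r\in]0,+\infty[}\left|\int_{Y\setminus\mathbb{B}_n(x,r)}\mathrm{grad}_{Y,x}K(x,y)\,d\sigma_y\right|<+\infty . \]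
   Context: Notation: $]a,b[$ denotes an open interval (similarly for half-open ones). $\mathbb{B}_n(x,\rho)=\{y\in\mathbb{R}^n:|x-y|<\rho\}$. $Y$ carries the Euclidean distance of $\mathbb{R}^n$, and $\sigma$ is the $(n-1)$-dimensional surface measure on $Y$. Functions are complex valued. Manifolds are without boundary. Kernels. For $s_1,s_2,s_3\in\mathbb{R}$, $\mathcal{K}_{s_1,s_2,s_3}(Y\times Y)$ is the set of continuous functions $K:\{(x,y)\in Y\times Y:x\neq y\}\to\mathbb{C}$ such that \[ \sup_{x,y\in Y,\,x\neq y}|x-y|^{s_1}|K(x,y)|+\sup\left\{\frac{|x'-y|^{s_2}}{|x'-x''|^{s_3}}|K(x',y)-K(x'',y)|:\ x',x''\in Y,\ x'\neq x'',\ y\in Y\setminus\mathbb{B}_n(x',2|x'-x''|)\right\}<+\infty . \] Tangential gradient. For $f$ of class $C^1$ on an open subset of $Y$, $\mathrm{grad}_Yf(x)\in\mathbb{C}^n$ is the tangential gradient of $f$ at $x$, i.e. the (complexified) tangent vector to $Y$ at $x$ whose bilinear product $\sum_j v_j(\mathrm{grad}_Yf(x))_j$ with each $v\in T_xY$ equals $df_x(v)$. $\mathrm{grad}_{Y,x}K(x,y)$ denotes the tangential gradient of $K(\cdot,y)$ at $x$. Membership in $(\mathcal{K}_{t_1,t_2,t_3}(Y\times Y))^n$ means that each of the $n$ components belongs to $\mathcal{K}_{t_1,t_2,t_3}(Y\times Y)$. Function spaces. $C^{0,\beta}(Y)$ is the space of $\beta$-Hölder continuous functions on the compact set $Y$,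 normed by the sup norm plus the $\beta$-Hölder constant. $C^{1,\beta}(Y)$ is the Schauder space of functions of class $C^1$ on $Y$ whose tangential gradient is $\beta$-Hölder continuous, normed by the sup norm of the function plus the $C^{0,\beta}$ norm of the tangential gradient. *)

theory Defs
  imports "HOL-Analysis.Analysis"
begin

text \<open>
  The sets of diameter larger than \<open>d\<close> get weight \<open>\<infinity>\<close>, so that they do not take part in
  the infimum over countable covers. The normalisation makes the \<open>m\<close>-dimensional Hausdorff measure
  agree with the \<open>m\<close>-dimensional Riemannian volume on \<open>m\<close>-dimensional submanifolds of class \<open>C\<^sup>1\<close>.
\<close>

definition hausdorff_gauge :: "nat \<Rightarrow> real \<Rightarrow> 'a::metric_space set \<Rightarrow> ennreal" where
  "hausdorff_gauge m d B =
     (if B = {} then 0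
      else if bounded B \<and> diameter B \<le> d
        then ennreal (unit_ball_vol (real m) * (diameter B / 2) ^ m)
      else \<infinity>)"

text \<open>
  The covers in \<^const>\<open>outer_measure\<close> are disjoint; since the gauge is monotone, this does not change
  the infimum.
\<close>

definition hausdorff_outer :: "nat \<Rightarrow> 'a::metric_space set \<Rightarrow> ennreal" where
  "hausdorff_outer m A = (SUP d\<in>{0<..}. outer_measure UNIV (hausdorff_gauge m d) A)"

definition hausdorff_measure :: "nat \<Rightarrow> 'a::metric_space measure" where
  "hausdorff_measure m = measure_of UNIV (sets borel) (hausdorff_outer m)"

definition surface_measure :: "(real ^ 'n) set \<Rightarrow> (real ^ 'n) measure" where
  "surface_measure Y = restrict_space (hausdorff_measure (CARD('n) - 1)) Y"

text \<open>
  \<^const>\<open>measure_of\<close> yields the zero measure if its argument is not countably additive. The facts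
  below (Caratheodory's criterion) show that this does not happen here.
\<close>

lemma hausdorff_gauge_mono: "A \<subseteq> B \<Longrightarrow> hausdorff_gauge m d A \<le> hausdorff_gauge m d B"
proof -
  assume *: "A \<subseteq> B"
  have "hausdorff_gauge m d A \<le> hausdorff_gauge m d B"
    if "A \<noteq> {}" "bounded B" "diameter B \<le> d"
  proof -
    have "diameter A \<le> diameter B" by (rule diameter_subset[OF * that(2)])
    moreover have "bounded A" using * that(2) bounded_subset by blast
    moreover have "0 \<le> diameter A" by (rule diameter_ge_0) fact
    moreover have "B \<noteq> {}" using * that by auto
    ultimately show ?thesis using that
      by (auto simp: hausdorff_gauge_def intro!: ennreal_leI mult_left_mono power_mono)
  qed
  moreover have "hausdorff_gauge m d B = \<infinity>" if "A \<noteq> {}" "\<not> (bounded B \<and> diameter B \<le> d)"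
    using * that by (auto simp: hausdorff_gauge_def)
  ultimately show ?thesis
    by (cases "A = {}"; cases "bounded B \<and> diameter B \<le> d") (auto simp: hausdorff_gauge_def[of m d "{}"])
qed

lemma hausdorff_gauge_antimono: "d \<le> e \<Longrightarrow> hausdorff_gauge m e A \<le> hausdorff_gauge m d A"
  by (auto simp: hausdorff_gauge_def)

lemma outer_measure_space_hausdorff_pre:
  "outer_measure_space UNIV (outer_measure UNIV (hausdorff_gauge m d))"
proof -
  interpret ring_of_sets UNIV "Pow UNIV" by (rule ring_of_sets_Pow)
  have "outer_measure_space (Pow UNIV) (outer_measure (Pow UNIV) (hausdorff_gauge m d))"
    by (rule outer_measure_space_outer_measure)
       (auto simp: positive_def increasing_def hausdorff_gauge_def[of m d "{}"] hausdorff_gauge_mono)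
  thus ?thesis by simp
qed

lemma outer_measure_space_hausdorff_outer: "outer_measure_space UNIV (hausdorff_outer m)"
proof -
  let ?p = "\<lambda>d. outer_measure UNIV (hausdorff_gauge m d)"
  have pos: "?p d {} = 0" and inc: "A \<subseteq> B \<Longrightarrow> ?p d A \<le> ?p d B"
    and sub: "disjoint_family C \<Longrightarrow> ?p d (\<Union>i. C i) \<le> (\<Sum>i. ?p d (C i))" for d A B C
    using outer_measure_space_hausdorff_pre[of m d]
    unfolding outer_measure_space_def positive_def increasing_def countably_subadditive_def by auto
  have "hausdorff_outer m {} = 0" by (simp add: hausdorff_outer_def pos)
  moreover have "hausdorff_outer m A \<le> hausdorff_outer m B" if "A \<subseteq> B" for A B :: "'a set"
    unfolding hausdorff_outer_def by (intro SUP_mono) (use inc[OF that] in blast)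
  moreover have "hausdorff_outer m (\<Union>i. C i) \<le> (\<Sum>i. hausdorff_outer m (C i))"
    if "disjoint_family C" for C :: "nat \<Rightarrow> 'a set"
    unfolding hausdorff_outer_def[of m "\<Union>i. C i"]
  proof (rule SUP_least)
    fix d :: real assume d: "d \<in> {0<..}"
    have "?p d (\<Union>i. C i) \<le> (\<Sum>i. ?p d (C i))" by (rule sub[OF that])
    also have "\<dots> \<le> (\<Sum>i. hausdorff_outer m (C i))"
      unfolding hausdorff_outer_def by (intro suminf_le SUP_upper d) auto
    finally show "?p d (\<Union>i. C i) \<le> (\<Sum>i. hausdorff_outer m (C i))" .
  qed
  ultimately show ?thesis
    by (auto simp: outer_measure_space_def positive_def increasing_def countably_subadditive_def)
qed

lemma hausdorff_outer_separated:
  assumes d: "0 < d" and sep: "\<And>a b. a \<in> A \<Longrightarrow> b \<in> B \<Longrightarrow> d \<le> dist a b"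
  shows "hausdorff_outer m A + hausdorff_outer m B \<le> hausdorff_outer m (A \<union> B)"
proof -
  let ?p = "\<lambda>d. outer_measure UNIV (hausdorff_gauge m d)"
  interpret ring_of_sets UNIV "Pow UNIV" by (rule ring_of_sets_Pow)
  have le: "?p e X \<le> (\<Sum>i. hausdorff_gauge m e (C i))" if "X \<subseteq> (\<Union>i. C i)"
    for e X and C :: "nat \<Rightarrow> 'a set"
    using outer_measure_le[of "hausdorff_gauge m e" C X] that
    by (simp add: positive_def increasing_def hausdorff_gauge_def[of m e "{}"] hausdorff_gauge_mono)
  have pm: "?p e X \<le> ?p e' X" if "e' \<le> e" for e e' X
    unfolding outer_measure_def
    by (intro INF_mono) (use hausdorff_gauge_antimono[OF that] in \<open>auto intro!: suminf_le\<close>)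
  have key: "?p e A + ?p e B \<le> ?p e (A \<union> B)" if "e < d" for e
    unfolding outer_measure_def[of _ _ "A \<union> B"]
  proof (rule INF_greatest)
    fix C :: "nat \<Rightarrow> 'a set"
    assume C: "C \<in> {C. range C \<subseteq> UNIV \<and> disjoint_family C \<and> A \<union> B \<subseteq> (\<Union>i. C i)}"
    let ?g = "hausdorff_gauge m e"
    have pt: "?g (C i \<inter> A) + ?g (C i \<inter> B) \<le> ?g (C i)" for i
    proof (cases "C i \<inter> A = {} \<or> C i \<inter> B = {}")
      case True
      have g: "?g ({} :: 'a set) = 0" by (simp add: hausdorff_gauge_def)
      have a: "?g (C i \<inter> A) \<le> ?g (C i)" and b: "?g (C i \<inter> B) \<le> ?g (C i)"
        by (auto intro!: hausdorff_gauge_mono)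
      from True show ?thesis
      proof
        assume "C i \<inter> A = {}" thus ?thesis using b g by simp
      next
        assume "C i \<inter> B = {}" thus ?thesis using a g by simp
      qed
    next
      case False
      then obtain a b where ab: "a \<in> C i" "a \<in> A" "b \<in> C i" "b \<in> B" by auto
      have "\<not> (bounded (C i) \<and> diameter (C i) \<le> e)"
        using diameter_bounded_bound[of "C i" a b] ab sep[of a b] that by auto
      hence "?g (C i) = \<infinity>" using ab by (auto simp: hausdorff_gauge_def)
      thus ?thesis by simp
    qed
    have "?p e A + ?p e B \<le> (\<Sum>i. ?g (C i \<inter> A)) + (\<Sum>i. ?g (C i \<inter> B))"
      by (intro add_mono le) (use C in auto)
    also have "\<dots> = (\<Sum>i. ?g (C i \<inter> A) + ?g (C i \<inter> B))" by (rule suminf_add) auto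
    also have "\<dots> \<le> (\<Sum>i. ?g (C i))" by (intro suminf_le pt) auto
    finally show "?p e A + ?p e B \<le> (\<Sum>i. ?g (C i))" .
  qed
  have ne: "{0::real<..} \<noteq> {}" by simp
  have "?p e A + ?p e' B \<le> hausdorff_outer m (A \<union> B)" if "0 < e" "0 < e'" for e e'
  proof -
    define r where "r = min (min e e') (d / 2)"
    have r: "r \<le> e" "r \<le> e'" "r < d" "0 < r" using that d by (auto simp: r_def)
    have "?p e A + ?p e' B \<le> ?p r A + ?p r B" by (intro add_mono pm r)
    also have "\<dots> \<le> ?p r (A \<union> B)" by (rule key[OF r(3)])
    also have "\<dots> \<le> hausdorff_outer m (A \<union> B)"
      unfolding hausdorff_outer_def by (rule SUP_upper) (use r in simp)
    finally show ?thesis .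
  qed
  hence "?p e A + hausdorff_outer m B \<le> hausdorff_outer m (A \<union> B)" if "0 < e" for e
    unfolding hausdorff_outer_def[of m B] using that
    by (subst ennreal_SUP_add_right[OF ne]) (auto intro!: SUP_least)
  thus ?thesis
    unfolding hausdorff_outer_def[of m A]
    by (subst ennreal_SUP_add_left[symmetric, OF ne]) (auto intro!: SUP_least)
qed

lemma hausdorff_outer_closed:
  assumes F: "closed F"
  shows "hausdorff_outer m (X \<inter> F) + hausdorff_outer m (X - F) \<le> hausdorff_outer m X"
proof (cases "F = {} \<or> hausdorff_outer m X = \<infinity>")
  case True
  moreover have "hausdorff_outer m {} = 0"
    using outer_measure_space_hausdorff_outer[of m] by (auto simp: outer_measure_space_def positive_def)
  ultimately show ?thesis by auto
next
  case False
  let ?f = "hausdorff_outer m"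
  have f0: "?f {} = 0" and inc: "\<And>A B. A \<subseteq> B \<Longrightarrow> ?f A \<le> ?f B"
    and csub: "\<And>C. disjoint_family C \<Longrightarrow> ?f (\<Union>i. C i) \<le> (\<Sum>i. ?f (C i))"
    using outer_measure_space_hausdorff_outer[of m]
    by (auto simp: outer_measure_space_def positive_def increasing_def countably_subadditive_def)
  have sub: "?f (A \<union> B) \<le> ?f A + ?f B" for A B
  proof -
    interpret ring_of_sets UNIV "Pow UNIV" by (rule ring_of_sets_Pow)
    have "subadditive UNIV ?f"
      using countably_subadditive_subadditive[of ?f] outer_measure_space_hausdorff_outer[of m]
      by (auto simp: outer_measure_space_def)
    hence "?f (A \<union> (B - A)) \<le> ?f A + ?f (B - A)" by (intro subadditiveD) auto
    also have "\<dots> \<le> ?f A + ?f B" by (intro add_left_mono inc) auto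
    finally show ?thesis by simp
  qed
  have lip: "infdist x F - infdist y F \<le> dist x y" for x y
    using infdist_triangle_abs[of x F y] by linarith
  define A where "A k = {x\<in>X. 1 / real (Suc k) \<le> infdist x F}" for k
  define R where "R k = {x\<in>X. 1 / real (Suc (Suc k)) \<le> infdist x F \<and> infdist x F < 1 / real (Suc k)}" for k
  have R_sum: "(\<Sum>i<n. ?f (R (2 * i + s))) \<le> ?f (\<Union>i<n. R (2 * i + s))" for n s
  proof (induction n)
    case 0
    then show ?case by simp
  next
    case (Suc n)
    define N where "N = 2 * n + s"
    let ?d = "1 / real N - 1 / real (Suc N)"
    show ?case
    proof (cases "n = 0")
      case True thus ?thesis by (simp add: lessThan_Suc)
    next
      case False
      have N: "N > 0" using False by (simp add: N_def)
      have "?f (\<Union>i<n. R (2 * i + s)) + ?f (R N) \<le> ?f ((\<Union>i<n. R (2 * i + s)) \<union> R N)"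
      proof (rule hausdorff_outer_separated)
        have "1 / real (Suc N) < 1 / real N" using N by (intro divide_strict_left_mono) auto
        thus "0 < ?d" by simp
        fix a b assume a: "a \<in> (\<Union>i<n. R (2 * i + s))" and b: "b \<in> R N"
        from a obtain i where i: "i < n" "1 / real (Suc (Suc (2 * i + s))) \<le> infdist a F"
          by (auto simp: R_def)
        have "Suc (Suc (2 * i + s)) \<le> N" using i by (simp add: N_def)
        hence "1 / real N \<le> 1 / real (Suc (Suc (2 * i + s)))"
          by (intro divide_left_mono) auto
        moreover have "infdist b F < 1 / real (Suc N)" using b by (auto simp: R_def)
        ultimately show "?d \<le> dist a b" using lip[of a b] i by linarith
      qed
      moreover have "(\<Union>i<Suc n. R (2 * i + s)) = (\<Union>i<n. R (2 * i + s)) \<union> R N"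
        by (auto simp: N_def lessThan_Suc)
      moreover have "(\<Sum>i<Suc n. ?f (R (2 * i + s))) = (\<Sum>i<n. ?f (R (2 * i + s))) + ?f (R N)"
        by (simp add: N_def)
      ultimately show ?thesis using order_trans[OF add_right_mono[OF Suc.IH, of "?f (R N)"]] by metis
    qed
  qed
  have R_sum': "(\<Sum>i<n. ?f (R (2 * i + s))) \<le> ?f X" for n s
    by (rule order_trans[OF R_sum inc]) (auto simp: R_def)
  have "(\<Sum>i<2 * n. ?f (R i)) = (\<Sum>i<n. ?f (R (2 * i + 0))) + (\<Sum>i<n. ?f (R (2 * i + 1)))" for n
    by (induction n) (auto simp: ac_simps)
  hence R2: "(\<Sum>i<2 * n. ?f (R i)) \<le> ?f X + ?f X" for n
    using add_mono[OF R_sum'[of 0 n] R_sum'[of 1 n]] by simp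
  have "(\<Sum>i<n. ?f (R i)) \<le> ?f X + ?f X" for n
    by (rule order_trans[OF _ R2[of n]]) (auto intro!: sum_mono2)
  hence "(\<Sum>i. ?f (R i)) \<le> ?f X + ?f X"
    by (intro suminf_le_const) auto
  moreover have Xfin: "?f X < top" using False by (simp add: less_top)
  ultimately have Rfin: "(\<Sum>i. ?f (R i)) \<noteq> top"
    by (metis ennreal_add_eq_top less_irrefl top_unique)
  have "?f (X \<inter> F) + ?f (X - F) \<le> ?f X + ennreal e" if e: "0 < e" for e
  proof -
    define r where "r i = enn2real (?f (R i))" for i
    have fr: "?f (R i) = ennreal (r i)" for i
      unfolding r_def using inc[of "R i" X] Xfin by (auto simp: R_def less_top)
    have r0: "0 \<le> r i" for i by (simp add: r_def)
    have sr: "summable r" using Rfin r0 by (simp add: fr summable_suminf_not_top)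
    obtain N where N: "norm (\<Sum>i. r (i + N)) < e"
      using suminf_exist_split[OF e sr] by blast
    have tail: "(\<Sum>i. ?f (R (i + N))) \<le> ennreal e"
    proof -
      have "(\<Sum>i. ?f (R (i + N))) = ennreal (\<Sum>i. r (i + N))"
        unfolding fr by (rule suminf_ennreal2) (use r0 sr in \<open>auto simp: summable_iff_shift\<close>)
      also have "\<dots> \<le> ennreal e" using N by (intro ennreal_leI) auto
      finally show ?thesis .
    qed
    have cover: "X - F \<subseteq> A N \<union> (\<Union>i. R (i + N))"
    proof
      fix x assume x: "x \<in> X - F"
      have pos: "0 < infdist x F"
        using infdist_pos_not_in_closed[OF F] False x by auto
      show "x \<in> A N \<union> (\<Union>i. R (i + N))"
      proof (cases "1 / real (Suc N) \<le> infdist x F")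
        case True thus ?thesis using x by (auto simp: A_def)
      next
        case False
        obtain k where k: "inverse (real (Suc k)) < infdist x F" using reals_Archimedean[OF pos] by auto
        define j where "j = (LEAST j. 1 / real (Suc j) \<le> infdist x F)"
        have ex: "1 / real (Suc k) \<le> infdist x F" using k by (simp add: inverse_eq_divide)
        have j: "1 / real (Suc j) \<le> infdist x F" unfolding j_def by (rule LeastI[of _ k]) (rule ex)
        have jN: "N < j"
        proof (rule ccontr)
          assume "\<not> N < j"
          hence "1 / real (Suc N) \<le> 1 / real (Suc j)" by (intro divide_left_mono) auto
          thus False using j False by simp
        qed
        have "\<not> 1 / real (Suc (j - 1)) \<le> infdist x F"
          using not_less_Least[of "j - 1" "\<lambda>j. 1 / real (Suc j) \<le> infdist x F", folded j_def] jN
          by simp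
        hence "x \<in> R (j - 1)" using x j jN by (auto simp: R_def)
        hence "x \<in> R ((j - 1 - N) + N)" using jN by simp
        thus ?thesis by blast
      qed
    qed
    have disj: "disjoint_family (\<lambda>i. R (i + N))"
      unfolding disjoint_family_on_def
    proof (intro ballI impI)
      have *: "R i \<inter> R j = {}" if "i < j" for i j
      proof -
        have "1 / real (Suc j) \<le> 1 / real (Suc (Suc i))" using that by (intro divide_left_mono) auto
        thus ?thesis by (auto simp: R_def)
      qed
      fix i j :: nat assume "i \<noteq> j"
      hence "i + N < j + N \<or> j + N < i + N" by auto
      thus "R (i + N) \<inter> R (j + N) = {}" using *[of "i + N" "j + N"] *[of "j + N" "i + N"] by blast
    qed
    have "?f (X - F) \<le> ?f (A N) + ennreal e"
    proof -
      have "?f (X - F) \<le> ?f (A N) + ?f (\<Union>i. R (i + N))"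
        by (rule order_trans[OF inc[OF cover] sub])
      also have "\<dots> \<le> ?f (A N) + ennreal e"
        by (intro add_left_mono order_trans[OF csub[OF disj] tail])
      finally show ?thesis .
    qed
    moreover have "?f (X \<inter> F) + ?f (A N) \<le> ?f X"
    proof -
      have "?f (X \<inter> F) + ?f (A N) \<le> ?f (X \<inter> F \<union> A N)"
      proof (rule hausdorff_outer_separated[of "1 / real (Suc N)"])
        fix a b assume "a \<in> X \<inter> F" "b \<in> A N"
        thus "1 / real (Suc N) \<le> dist a b" using lip[of b a] by (auto simp: A_def dist_commute)
      qed simp
      also have "\<dots> \<le> ?f X" by (rule inc) (auto simp: A_def)
      finally show ?thesis .
    qed
    ultimately have "?f (X \<inter> F) + ?f (X - F) \<le> ?f (X \<inter> F) + (?f (A N) + ennreal e)"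
      and "?f (X \<inter> F) + ?f (A N) + ennreal e \<le> ?f X + ennreal e"
      by (auto intro: add_left_mono add_right_mono)
    thus ?thesis unfolding add.assoc by (rule order_trans)
  qed
  thus ?thesis by (rule ennreal_le_epsilon)
qed

lemma measure_space_hausdorff_outer:
  "measure_space UNIV (sets (borel :: 'a::metric_space measure)) (hausdorff_outer m)"
proof -
  interpret sigma_algebra UNIV "UNIV :: 'a set set"
    using sigma_algebra_Pow[of UNIV] by simp
  let ?L = "lambda_system UNIV (UNIV :: 'a set set) (hausdorff_outer m)"
  have oms: "outer_measure_space (UNIV :: 'a set set) (hausdorff_outer m)"
    by (rule outer_measure_space_hausdorff_outer)
  have ms: "measure_space UNIV ?L (hausdorff_outer m)"
    by (rule caratheodory_lemma[OF oms])
  have sub: "hausdorff_outer m (A \<union> B) \<le> hausdorff_outer m A + hausdorff_outer m B" if "A \<inter> B = {}" for A B :: "'a set"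
    using countably_subadditive_subadditive[of "hausdorff_outer m"] oms that
    by (auto simp: outer_measure_space_def subadditive_def)
  have "F \<in> ?L" if "closed F" for F
    unfolding lambda_system_eq
  proof (safe intro!: antisym)
    fix X
    show "hausdorff_outer m (X \<inter> F) + hausdorff_outer m (X - F) \<le> hausdorff_outer m X"
      by (rule hausdorff_outer_closed[OF that])
    show "hausdorff_outer m X \<le> hausdorff_outer m (X \<inter> F) + hausdorff_outer m (X - F)"
    proof -
      have "X \<inter> F \<union> (X - F) = X" "(X \<inter> F) \<inter> (X - F) = {}" by auto
      thus ?thesis using sub[of "X \<inter> F" "X - F"] by simp
    qed
  qed auto
  hence "Collect closed \<subseteq> ?L" by blast
  moreover have "sigma_algebra UNIV ?L" using ms by (simp add: measure_space_def)
  ultimately have "sigma_sets UNIV (Collect closed) \<subseteq> ?L"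
    by (intro sigma_algebra.sigma_sets_subset)
  hence L: "sets borel \<subseteq> ?L" by (simp add: borel_eq_closed)
  have ca: "countably_additive ?L (hausdorff_outer m)" using ms by (simp add: measure_space_def)
  have "countably_additive (sets (borel :: 'a measure)) (hausdorff_outer m)"
    unfolding countably_additive_def
  proof (intro allI impI)
    fix C :: "nat \<Rightarrow> 'a set"
    assume C: "range C \<subseteq> sets borel" and "disjoint_family C" "\<Union> (range C) \<in> sets borel"
    moreover have "range C \<subseteq> ?L" using C L by (rule subset_trans)
    moreover have "\<Union> (range C) \<in> ?L" using \<open>\<Union> (range C) \<in> sets borel\<close> L by (rule subsetD[rotated])
    ultimately show "(\<Sum>i. hausdorff_outer m (C i)) = hausdorff_outer m (\<Union> (range C))"
      using ca unfolding countably_additive_def by simp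
  qed
  moreover have "positive (sets (borel :: 'a measure)) (hausdorff_outer m)"
    using ms by (simp add: measure_space_def positive_def)
  moreover have "sigma_algebra UNIV (sets (borel :: 'a measure))"
    using sets.sigma_algebra_axioms[of "borel :: 'a measure"] by simp
  ultimately show ?thesis by (simp add: measure_space_def)
qed

lemma space_hausdorff_measure [simp]: "space (hausdorff_measure m :: 'a::metric_space measure) = UNIV"
  and sets_hausdorff_measure [simp, measurable_cong]: "sets (hausdorff_measure m :: 'a::metric_space measure) = sets borel"
proof -
  have "sigma_sets UNIV (sets borel) = sets (borel :: 'a measure)"
    using sets.sigma_sets_eq[of "borel :: 'a measure"] by (simp only: space_borel)
  thus "space (hausdorff_measure m :: 'a measure) = UNIV"
    and "sets (hausdorff_measure m :: 'a measure) = sets borel"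
    by (simp_all only: hausdorff_measure_def space_measure_of_conv sets_measure_of_conv Pow_UNIV
          subset_UNIV if_True)
qed

lemma emeasure_hausdorff_measure:
  "A \<in> sets borel \<Longrightarrow> emeasure (hausdorff_measure m) A = hausdorff_outer m A"
  unfolding hausdorff_measure_def using measure_space_hausdorff_outer[of m, unfolded measure_space_def]
  by (intro emeasure_measure_of_sigma) auto

definition C1_on :: "'a::real_normed_vector set \<Rightarrow> ('a \<Rightarrow> 'b::real_normed_vector) \<Rightarrow> bool" where
  "C1_on W F \<longleftrightarrow> open W \<and>
     (\<exists>F' :: 'a \<Rightarrow> 'a \<Rightarrow>\<^sub>L 'b. continuous_on W F' \<and>
        (\<forall>x\<in>W. (F has_derivative blinfun_apply (F' x)) (at x)))"

text \<open>
  Embedded \<open>m\<close>-dimensional submanifold without boundary: near each of its points, \<open>Y\<close> is straightened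
  to an \<open>m\<close>-dimensional linear subspace by a diffeomorphism of class \<open>C\<^sup>1\<close> between open sets.
\<close>

definition C1_submanifold :: "nat \<Rightarrow> 'a::euclidean_space set \<Rightarrow> bool" where
  "C1_submanifold m Y \<longleftrightarrow>
     (\<forall>p\<in>Y. \<exists>W V S (\<Phi> :: 'a \<Rightarrow> 'a) (\<Psi> :: 'a \<Rightarrow> 'a).
        p \<in> W \<and> C1_on W \<Phi> \<and> C1_on V \<Psi> \<and> homeomorphism W V \<Phi> \<Psi> \<and>
        subspace S \<and> dim S = m \<and> \<Phi> ` (Y \<inter> W) = V \<inter> S)"

text \<open>
  Class \<open>C\<^sup>1\<close> on a (relatively open) subset \<open>U\<close> of a submanifold: locally the restriction of a function
  of class \<open>C\<^sup>1\<close> on an open set of the ambient space.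
\<close>

definition C1_on_manifold :: "'a::real_normed_vector set \<Rightarrow> ('a \<Rightarrow> 'b::real_normed_vector) \<Rightarrow> bool" where
  "C1_on_manifold U f \<longleftrightarrow> (\<forall>p\<in>U. \<exists>W F. p \<in> W \<and> C1_on W F \<and> (\<forall>x\<in>W \<inter> U. F x = f x))"

definition tangent_space :: "'a::real_normed_vector set \<Rightarrow> 'a \<Rightarrow> 'a set" where
  "tangent_space Y x =
     {v. \<exists>e>0. \<exists>\<gamma>. \<gamma> C1_differentiable_on {-e<..<e} \<and> \<gamma> ` {-e<..<e} \<subseteq> Y \<and>
         \<gamma> 0 = x \<and> (\<gamma> has_vector_derivative v) (at 0)}"

text \<open>
  A derivative \<open>D\<close> of \<open>f\<close> at \<open>x\<close> within \<open>Y\<close> is determined only on the tangent space, where it is the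
  differential of \<open>f\<close>. A complex vector belongs to the complexified tangent space iff its
  real and imaginary parts are tangent.
\<close>

definition tangential_gradient ::
    "(real ^ 'n) set \<Rightarrow> (real ^ 'n \<Rightarrow> complex) \<Rightarrow> real ^ 'n \<Rightarrow> complex ^ 'n" where
  "tangential_gradient Y f x =
     (THE g. (\<chi> j. Re (g $ j)) \<in> tangent_space Y x \<and> (\<chi> j. Im (g $ j)) \<in> tangent_space Y x \<and>
        (\<exists>D. (f has_derivative D) (at x within Y) \<and>
             (\<forall>v\<in>tangent_space Y x. (\<Sum>j\<in>UNIV. of_real (v $ j) * g $ j) = D v)))"

definition kernel_class ::
    "real \<Rightarrow> real \<Rightarrow> real \<Rightarrow> 'a::metric_space set \<Rightarrow> ('a \<Rightarrow> 'a \<Rightarrow> complex) set" where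
  "kernel_class s1 s2 s3 Y =
     {K. continuous_on {(x, y). x \<in> Y \<and> y \<in> Y \<and> x \<noteq> y} (\<lambda>(x, y). K x y) \<and>
         (SUP (x, y) \<in> {(x, y). x \<in> Y \<and> y \<in> Y \<and> x \<noteq> y}.
            ennreal (dist x y powr s1 * norm (K x y))) +
         (SUP (x', x'', y) \<in> {(x', x'', y). x' \<in> Y \<and> x'' \<in> Y \<and> x' \<noteq> x'' \<and>
                                 y \<in> Y - ball x' (2 * dist x' x'')}.
            ennreal (dist x' y powr s2 / dist x' x'' powr s3 * norm (K x' y - K x'' y)))
         < \<infinity>}"

text \<open>
  Elements of the spaces are represented by total functions whose values outside \<open>Y\<close> are
  irrelevant. The norms may take the value \<open>\<infinity>\<close> outside the spaces.
\<close>

definition sup_norm_on :: "'a set \<Rightarrow> ('a \<Rightarrow> 'b::real_normed_vector) \<Rightarrow> ennreal" where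
  "sup_norm_on Y f = (SUP x\<in>Y. ennreal (norm (f x)))"

definition holder_norm ::
    "real \<Rightarrow> 'a::metric_space set \<Rightarrow> ('a \<Rightarrow> 'b::real_normed_vector) \<Rightarrow> ennreal" where
  "holder_norm \<beta> Y f = sup_norm_on Y f +
     (SUP (x, y) \<in> {(x, y). x \<in> Y \<and> y \<in> Y \<and> x \<noteq> y}.
        ennreal (norm (f x - f y) / dist x y powr \<beta>))"

definition holder_space ::
    "real \<Rightarrow> 'a::metric_space set \<Rightarrow> ('a \<Rightarrow> 'b::real_normed_vector) set" where
  "holder_space \<beta> Y = {f. holder_norm \<beta> Y f < \<infinity>}"

definition schauder_norm :: "real \<Rightarrow> (real ^ 'n) set \<Rightarrow> (real ^ 'n \<Rightarrow> complex) \<Rightarrow> ennreal" where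
  "schauder_norm \<beta> Y f = sup_norm_on Y f + holder_norm \<beta> Y (tangential_gradient Y f)"

definition schauder_space :: "real \<Rightarrow> (real ^ 'n) set \<Rightarrow> (real ^ 'n \<Rightarrow> complex) set" where
  "schauder_space \<beta> Y = {f. C1_on_manifold Y f \<and> tangential_gradient Y f \<in> holder_space \<beta> Y}"

text \<open>
  \<open>NE\<close> and \<open>NG\<close> are the norms of the function spaces \<open>E\<close> and \<open>G\<close>; values outside \<open>Y\<close> do not count, so
  linearity is an identity on \<open>Y\<close> only.
\<close>

definition linear_continuous_map ::
    "'a set \<Rightarrow> ('a \<Rightarrow> complex) set \<Rightarrow> (('a \<Rightarrow> complex) \<Rightarrow> ennreal) \<Rightarrow>
     ('a \<Rightarrow> complex) set \<Rightarrow> (('a \<Rightarrow> complex) \<Rightarrow> ennreal) \<Rightarrow>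
     (('a \<Rightarrow> complex) \<Rightarrow> 'a \<Rightarrow> complex) \<Rightarrow> bool" where
  "linear_continuous_map Y E NE G NG T \<longleftrightarrow>
     (\<forall>\<mu>\<in>E. T \<mu> \<in> G) \<and>
     (\<forall>\<mu>\<in>E. \<forall>\<nu>\<in>E. \<forall>a b. \<forall>x\<in>Y. T (\<lambda>y. a * \<mu> y + b * \<nu> y) x = a * T \<mu> x + b * T \<nu> x) \<and>
     (\<forall>\<mu>\<in>E. \<forall>\<epsilon>>0. \<exists>\<delta>>0. \<forall>\<nu>\<in>E.
        NE (\<lambda>y. \<nu> y - \<mu> y) < ennreal \<delta> \<longrightarrow> NG (\<lambda>x. T \<nu> x - T \<mu> x) < ennreal \<epsilon>)"

text \<open>
  The value \<open>K x x\<close> is arbitrary, but it does not affect the integral, since points are null sets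
  in positive dimension.
\<close>

definition integral_operator ::
    "(real ^ 'n) set \<Rightarrow> (real ^ 'n \<Rightarrow> real ^ 'n \<Rightarrow> complex) \<Rightarrow> (real ^ 'n \<Rightarrow> complex) \<Rightarrow> real ^ 'n \<Rightarrow> complex" where
  "integral_operator Y K \<mu> x = (LINT y|surface_measure Y. K x y * \<mu> y)"

end

theory Submission
  imports Defs
begin

text \<open>
  Let \<open>b\<close> be a cutoff that is \<open>1\<close> on the ball of radius \<open>r\<close> around \<open>x\<close> and \<open>0\<close> off the ball of radius
  \<open>2 r\<close>. Its \<open>\<beta>\<close>-Hoelder norm is of order \<open>r powr -\<beta>\<close>, and hence so is the \<open>\<beta>\<close>-Hoelder constant of the
  tangential gradient of its image under the integral operator. On distances of order \<open>r\<close> this gradient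
  therefore oscillates by a bounded amount only. At a point of \<open>Y\<close> whose distance from \<open>x\<close> is between
  \<open>4 r\<close> and a multiple of \<open>r\<close>, differentiation under the integral sign bounds it by
  \<open>r powr -(n - 1)\<close> times the measure of the ball, that is, by a constant. Hence it is bounded at \<open>x\<close>
  too. The image of the constant \<open>1\<close> has a bounded gradient, and so has the image of \<open>1 - b\<close>; at \<open>x\<close>
  the latter is the integral of the gradient kernel against \<open>1 - b\<close>, which differs from the truncated
  integral by an integral over an annulus that is again bounded.
\<close>

text \<open>The gradient kernel has the critical order: its size \<open>r powr -(n - 1)\<close> at
  distance \<open>r\<close> and the measure of a ball of radius \<open>r\<close> cancel. Bounds by
  absolute values over dyadic annuli therefore add up to a logarithm, and size alone does not bound
  the truncated integrals. The loss \<open>r powr -\<beta>\<close> in the norm of the cutoff is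
  repaid by the factor \<open>r powr \<beta>\<close> of a Hoelder estimate over distances of order
  \<open>r\<close>. To use continuity in its epsilon-delta form, the cutoff is scaled by a multiple
  of \<open>r powr \<beta>\<close>, which puts it into a fixed neighbourhood of zero.
  Differentiability of the images is part of the hypothesis, so gradients only have to be
  identified: one sequence of difference quotients along each curve suffices. The geometry of
  \<open>Y\<close> enters through the measure of small balls and the existence of the remote point,
  both uniform in \<open>x\<close> and \<open>r\<close>.\<close>

section \<open>Hausdorff measure of compact submanifolds\<close>

text \<open>Since \<open>N\<close> is free, \<open>b / N\<close> can be pushed below every scale
  \<open>d\<close> of the supremum, while \<open>N ^ m\<close> sets of gauge of order
  \<open>(b / N) ^ m\<close> keep the same total. One bound thus serves all scales.\<close>

lemma hausdorff_outer_le_cover: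
  fixes A :: "'a::metric_space set"
  assumes cover: "\<And>N::nat. N > 0 \<Longrightarrow> \<exists>I. finite I \<and> card I \<le> N ^ m \<and> A \<subseteq> \<Union>I \<and>
      (\<forall>C\<in>I. \<forall>u\<in>C. \<forall>v\<in>C. dist u v \<le> b / real N)"
    and b: "0 \<le> b"
  shows "hausdorff_outer m A \<le> ennreal (unit_ball_vol (real m) * (b / 2) ^ m)"
  unfolding hausdorff_outer_def
proof (rule SUP_least)
  fix d :: real assume d: "d \<in> {0<..}"
  interpret ring_of_sets UNIV "Pow UNIV" by (rule ring_of_sets_Pow)
  obtain N :: nat where N: "b / d < real N" using reals_Archimedean2 by blast
  have "0 \<le> b / d" using b d by simp
  hence N0: "N > 0" using N by (cases N) auto
  have bN: "b / real N \<le> d" using N N0 d by (simp add: field_simps)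
  obtain I where I: "finite I" "card I \<le> N ^ m" "A \<subseteq> \<Union>I"
    and C: "\<And>C u v. C \<in> I \<Longrightarrow> u \<in> C \<Longrightarrow> v \<in> C \<Longrightarrow> dist u v \<le> b / real N"
    using cover[OF N0] by blast
  obtain h where h: "bij_betw h {..<card I} I" using ex_bij_betw_nat_finite[OF I(1)] by (auto simp: lessThan_atLeast0)
  \<comment> \<open>\<open>outer_measure\<close> runs over sequences of sets, so the finite family
    is padded with empty sets, whose gauge is \<open>0\<close>.\<close>
  define E where "E i = (if i < card I then h i else {})" for i
  have hI: "h i \<in> I" if "i < card I" for i using h that by (auto simp: bij_betw_def)
  have AE: "A \<subseteq> (\<Union>i. E i)"
  proof
    fix a assume "a \<in> A"
    then obtain i where i: "i \<in> I" "a \<in> i" using I by auto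
    have "i \<in> h ` {..<card I}" using h i by (simp add: bij_betw_def)
    then obtain k where "k < card I" "h k = i" by auto
    with i show "a \<in> (\<Union>i. E i)" by (auto simp: E_def intro!: exI[of _ k])
  qed
  let ?g = "hausdorff_gauge m d"
  let ?w = "unit_ball_vol (real m) * (b / real N / 2) ^ m"
  have w0: "0 \<le> ?w" using b by (auto simp: unit_ball_vol_nonneg)
  have g: "?g (E i) \<le> ennreal ?w" if "i < card I" for i
  proof (cases "E i = {}")
    case True
    then show ?thesis by (simp add: hausdorff_gauge_def)
  next
    case False
    have di: "dist u v \<le> b / real N" if "u \<in> E i" "v \<in> E i" for u v
      using C hI \<open>i < card I\<close> that by (auto simp: E_def)
    have bd: "bounded (E i)" unfolding bounded_two_points using di by blast
    moreover have dm: "diameter (E i) \<le> b / real N"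
      unfolding diameter_def using di False by (auto intro!: cSUP_least)
    ultimately show ?thesis using False bN diameter_ge_0[OF bd]
      by (auto simp: hausdorff_gauge_def intro!: ennreal_leI mult_left_mono power_mono)
  qed
  have "outer_measure UNIV ?g A \<le> (\<Sum>i. ?g (E i))"
    using outer_measure_le[of ?g E A] AE
    by (simp add: positive_def increasing_def hausdorff_gauge_def[of m d "{}"] hausdorff_gauge_mono)
  also have "\<dots> = (\<Sum>i<card I. ?g (E i))"
    by (rule suminf_finite) (auto simp: E_def hausdorff_gauge_def)
  also have "\<dots> \<le> (\<Sum>i<card I. ennreal ?w)" by (intro sum_mono g) auto
  also have "\<dots> = ennreal (real (card I) * ?w)" using w0 by (simp add: ennreal_mult ennreal_of_nat_eq_real_of_nat)
  also have "\<dots> \<le> ennreal (real (N ^ m) * ?w)"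
    using I(2) w0 by (intro ennreal_leI mult_right_mono) linarith+
  also have "real (N ^ m) * ?w = unit_ball_vol (real m) * (b / 2) ^ m"
    using N0 by (simp add: power_divide field_simps)
  finally show "outer_measure UNIV ?g A \<le> ennreal (unit_ball_vol (real m) * (b / 2) ^ m)" .
qed

text \<open>
  A ball in \<open>S\<close> is covered by \<open>N ^ m\<close> cells of diameter \<open>O(\<rho> / N)\<close>. Their total gauge does not
  depend on \<open>N\<close>, so no comparison with Lebesgue measure is needed.
\<close>

lemma hausdorff_outer_lipschitz_subspace_image:
  fixes f :: "'a::euclidean_space \<Rightarrow> 'b::metric_space"
  assumes S: "subspace S" "dim S = m" and A: "A \<subseteq> S" "A \<subseteq> cball z \<rho>" and \<rho>: "0 \<le> \<rho>" and L: "0 \<le> L"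
    and lip: "\<And>u v. u \<in> A \<Longrightarrow> v \<in> A \<Longrightarrow> dist (f u) (f v) \<le> L * dist u v"
  shows "hausdorff_outer m (f ` A) \<le> ennreal (unit_ball_vol (real m) * (L * (real m * \<rho>)) ^ m)"
proof -
  obtain B where B: "B \<subseteq> S" "pairwise orthogonal B" "\<And>x. x \<in> B \<Longrightarrow> norm x = 1"
     "independent B" "card B = dim S" "span B = S"
    using orthonormal_basis_subspace[OF S(1)] by blast
  have finB: "finite B" using B(4) independent_bound by blast
  \<comment> \<open>In an orthonormal basis the norm is at most the sum of the moduli of the
    coordinates. This crude bound puts the factor \<open>real m\<close> into the diameter of a
    cell.\<close>
  have ex: "norm w \<le> (\<Sum>b\<in>B. \<bar>w \<bullet> b\<bar>)" if "w \<in> S" for w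
  proof -
    have "w = (\<Sum>b\<in>B. (w \<bullet> b) *\<^sub>R b)"
      using orthonormal_basis_expand[of B w] B finB that by (auto simp: pairwise_def inner_commute)
    hence "norm w \<le> (\<Sum>b\<in>B. norm ((w \<bullet> b) *\<^sub>R b))" by (metis norm_sum)
    thus ?thesis using B(3) by simp
  qed
  have "hausdorff_outer m (f ` A) \<le> ennreal (unit_ball_vol (real m) * (2 * L * real m * \<rho> / 2) ^ m)"
  proof (rule hausdorff_outer_le_cover)
    show "0 \<le> 2 * L * real m * \<rho>" using L \<rho> by simp
    fix N :: nat assume N: "N > 0"
    define I where "I = (B \<rightarrow>\<^sub>E {..<N})"
    define c where "c k b = z \<bullet> b - \<rho> + 2 * \<rho> * real (k b) / real N" for k :: "'a \<Rightarrow> nat" and b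
    \<comment> \<open>The cells are closed along every basis vector: the end of one grid step is the
      start of the next, so no point of \<open>A\<close> falls between cells.\<close>
    define C where "C k = {u\<in>A. \<forall>b\<in>B. c k b \<le> u \<bullet> b \<and> u \<bullet> b \<le> c k b + 2 * \<rho> / real N}" for k
    have "finite I" unfolding I_def using finB by (intro finite_PiE) auto
    moreover have "card I \<le> N ^ m" unfolding I_def using finB B S by (simp add: card_PiE)
    moreover have "f ` A \<subseteq> (\<Union>k\<in>I. f ` C k)"
    proof -
      have "\<exists>k\<in>I. u \<in> C k" if u: "u \<in> A" for u
      proof -
        have j: "\<exists>j<N. z \<bullet> b - \<rho> + 2 * \<rho> * real j / real N \<le> u \<bullet> b \<and>
              u \<bullet> b \<le> z \<bullet> b - \<rho> + 2 * \<rho> * real j / real N + 2 * \<rho> / real N" if b: "b \<in> B" for b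
        proof -
          have "\<bar>(u - z) \<bullet> b\<bar> \<le> norm (u - z) * norm b" by (rule Cauchy_Schwarz_ineq2)
          also have "\<dots> \<le> \<rho>" using u A b B(3) by (auto simp: dist_norm norm_minus_commute)
          finally have ab: "\<bar>u \<bullet> b - z \<bullet> b\<bar> \<le> \<rho>" by (simp add: inner_diff_left)
          define s where "s = u \<bullet> b - z \<bullet> b + \<rho>"
          have s: "0 \<le> s" "s \<le> 2 * \<rho>" using ab by (auto simp: s_def)
          \<comment> \<open>If no grid step contained \<open>s\<close>, induction would place
            \<open>s\<close> at or beyond every grid point, hence \<open>s = 2 * \<rho>\<close>; but
            then the last step \<open>j = N - 1\<close> contains it.\<close>
          have "\<exists>j<N. 2 * \<rho> * real j / real N \<le> s \<and> s \<le> 2 * \<rho> * real (Suc j) / real N"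
          proof (rule ccontr)
            assume *: "\<not> ?thesis"
            have "2 * \<rho> * real j / real N \<le> s" if "j \<le> N" for j
              using that
            proof (induction j)
              case 0 thus ?case using s by simp
            next
              case (Suc j)
              thus ?case using * by (metis Suc_le_eq Suc_leD nle_le)
            qed
            from this[of N] have "s = 2 * \<rho>" using s N by simp
            moreover have "2 * \<rho> * real (N - 1) / real N \<le> 2 * \<rho>"
              using N \<rho> by (simp add: field_simps mult_left_mono)
            ultimately show False using * N
              by (metis Suc_pred' diff_less nonzero_mult_div_cancel_right not_gr_zero of_nat_0_eq_iff order_refl zero_less_one)
          qed
          then obtain j where "j < N" "2 * \<rho> * real j / real N \<le> s" "s \<le> 2 * \<rho> * real (Suc j) / real N"
            by blast
          thus ?thesis by (intro exI[of _ j]) (simp add: s_def distrib_left add_divide_distrib)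
        qed
        then obtain k where k: "\<And>b. b \<in> B \<Longrightarrow> k b < N \<and> z \<bullet> b - \<rho> + 2 * \<rho> * real (k b) / real N \<le> u \<bullet> b \<and>
              u \<bullet> b \<le> z \<bullet> b - \<rho> + 2 * \<rho> * real (k b) / real N + 2 * \<rho> / real N" by metis
        have "restrict k B \<in> I" using k by (auto simp: I_def)
        moreover have "u \<in> C (restrict k B)" using k u by (auto simp: C_def c_def)
        ultimately show ?thesis by blast
      qed
      thus ?thesis by blast
    qed
    moreover have "\<forall>k\<in>I. \<forall>x\<in>f ` C k. \<forall>y\<in>f ` C k. dist x y \<le> 2 * L * real m * \<rho> / real N"
    proof (intro ballI)
      fix k x y assume "k \<in> I" "x \<in> f ` C k" "y \<in> f ` C k"
      then obtain u v where uv: "u \<in> C k" "v \<in> C k" and xy: "x = f u" "y = f v" by auto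
      have "u - v \<in> S" using uv A S by (auto simp: C_def intro: subspace_diff)
      hence "dist u v \<le> (\<Sum>b\<in>B. \<bar>(u - v) \<bullet> b\<bar>)" using ex by (simp add: dist_norm)
      also have "\<dots> \<le> (\<Sum>b\<in>B. 2 * \<rho> / real N)"
      proof (rule sum_mono)
        fix b assume b: "b \<in> B"
        have "c k b \<le> u \<bullet> b" "u \<bullet> b \<le> c k b + 2 * \<rho> / real N" "c k b \<le> v \<bullet> b" "v \<bullet> b \<le> c k b + 2 * \<rho> / real N"
          using uv b unfolding C_def by auto
        thus "\<bar>(u - v) \<bullet> b\<bar> \<le> 2 * \<rho> / real N" by (simp add: inner_diff_left)
      qed
      also have "\<dots> = real m * (2 * \<rho> / real N)" using B S by simp
      finally have "L * dist u v \<le> L * (real m * (2 * \<rho> / real N))" using L by (rule mult_left_mono)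
      moreover have "dist x y \<le> L * dist u v" unfolding xy using uv by (intro lip) (auto simp: C_def)
      ultimately show "dist x y \<le> 2 * L * real m * \<rho> / real N" by (simp add: mult_ac)
    qed
    moreover have "card ((\<lambda>k. f ` C k) ` I) \<le> card I" by (rule card_image_le) fact
    ultimately show "\<exists>I. finite I \<and> card I \<le> N ^ m \<and> f ` A \<subseteq> \<Union>I \<and>
      (\<forall>C\<in>I. \<forall>u\<in>C. \<forall>v\<in>C. dist u v \<le> 2 * L * real m * \<rho> / real N)"
      by (intro exI[of _ "(\<lambda>k. f ` C k) ` I"]) force
  qed
  thus ?thesis by (simp add: mult_ac)
qed

text \<open>By continuity the derivative stays within distance \<open>1\<close> of its value at
  \<open>p\<close> on a small ball; balls are convex, so the mean value inequality applies.\<close>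

lemma C1_on_locally_lipschitz:
  fixes F :: "'a::real_normed_vector \<Rightarrow> 'b::real_normed_vector"
  assumes F: "C1_on W F" and p: "p \<in> W"
  obtains \<rho> M where "0 < \<rho>" "0 < M" "ball p \<rho> \<subseteq> W"
    "\<And>u v. u \<in> ball p \<rho> \<Longrightarrow> v \<in> ball p \<rho> \<Longrightarrow> dist (F u) (F v) \<le> M * dist u v"
proof -
  obtain F' where W: "open W" and F': "continuous_on W F'"
    "\<And>x. x \<in> W \<Longrightarrow> (F has_derivative blinfun_apply (F' x)) (at x)"
    using F unfolding C1_on_def by blast
  obtain e where e: "0 < e" "ball p e \<subseteq> W" using W p by (auto simp: open_contains_ball)
  obtain d where d: "0 < d" "\<And>x. x \<in> W \<Longrightarrow> dist x p < d \<Longrightarrow> dist (F' x) (F' p) < 1"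
    using F'(1) p unfolding continuous_on_iff by (metis zero_less_one)
  define \<rho> where "\<rho> = min e d"
  define M where "M = norm (F' p) + 1"
  have bW: "ball p \<rho> \<subseteq> W" using e by (auto simp: \<rho>_def)
  have on: "onorm (blinfun_apply (F' x)) \<le> M" if "x \<in> ball p \<rho>" for x
  proof -
    have "dist (F' x) (F' p) < 1" using that bW by (intro d) (auto simp: \<rho>_def dist_commute)
    hence "norm (F' x) \<le> M" unfolding M_def dist_norm by norm
    thus ?thesis by (simp add: norm_blinfun.rep_eq)
  qed
  have "dist (F u) (F v) \<le> M * dist u v" if "u \<in> ball p \<rho>" "v \<in> ball p \<rho>" for u v
    unfolding dist_norm
  proof (rule differentiable_bound[OF convex_ball _ on that])
    fix x assume "x \<in> ball p \<rho>"
    thus "(F has_derivative blinfun_apply (F' x)) (at x within ball p \<rho>)"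
      using F'(2) bW by (blast intro: has_derivative_at_withinI)
  qed
  moreover have "0 < M" unfolding M_def by (simp add: add_nonneg_pos)
  ultimately show ?thesis using that[of \<rho> M] bW e d by (auto simp: \<rho>_def)
qed

lemma C1_submanifold_chart:
  fixes Y :: "'a::euclidean_space set"
  assumes "C1_submanifold m Y" "p \<in> Y"
  obtains W V S and \<Phi> \<Psi> :: "'a \<Rightarrow> 'a" where "p \<in> W" "C1_on W \<Phi>" "C1_on V \<Psi>" "subspace S" "dim S = m"
    "\<And>x. x \<in> W \<Longrightarrow> \<Phi> x \<in> V" "\<And>x. x \<in> W \<Longrightarrow> \<Psi> (\<Phi> x) = x"
    "\<And>z. z \<in> V \<Longrightarrow> \<Psi> z \<in> W" "\<And>z. z \<in> V \<Longrightarrow> \<Phi> (\<Psi> z) = z"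
    "\<And>x. x \<in> Y \<Longrightarrow> x \<in> W \<Longrightarrow> \<Phi> x \<in> S" "\<And>z. z \<in> V \<Longrightarrow> z \<in> S \<Longrightarrow> \<Psi> z \<in> Y"
proof -
  obtain W V S and \<Phi> \<Psi> :: "'a \<Rightarrow> 'a" where *: "p \<in> W" "C1_on W \<Phi>" "C1_on V \<Psi>" "homeomorphism W V \<Phi> \<Psi>"
    "subspace S" "dim S = m" "\<Phi> ` (Y \<inter> W) = V \<inter> S"
    using assms unfolding C1_submanifold_def by blast
  note h = *(4)[unfolded homeomorphism_def]
  have hW: "\<And>x. x \<in> W \<Longrightarrow> \<Phi> x \<in> V" "\<And>x. x \<in> W \<Longrightarrow> \<Psi> (\<Phi> x) = x" using h by blast+
  moreover have "\<And>z. z \<in> V \<Longrightarrow> \<Psi> z \<in> W" "\<And>z. z \<in> V \<Longrightarrow> \<Phi> (\<Psi> z) = z" using h by blast+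
  moreover have "\<And>x. x \<in> Y \<Longrightarrow> x \<in> W \<Longrightarrow> \<Phi> x \<in> S" using *(7) by blast
  moreover have "\<Psi> z \<in> Y" if z: "z \<in> V" "z \<in> S" for z
  proof -
    have "z \<in> \<Phi> ` (Y \<inter> W)" using z *(7) by blast
    then obtain x where "x \<in> Y" "x \<in> W" "z = \<Phi> x" by blast
    thus ?thesis using hW by simp
  qed
  ultimately show ?thesis using that[of W \<Phi> V \<Psi> S] * by blast
qed

text \<open>
  The point \<open>y\<close> at distance comparable to \<open>r\<close>, but outside \<open>ball x (4 * r)\<close>, is where the integral
  over \<open>ball x (2 * r)\<close> is not singular.
\<close>

lemma submanifold_regular_local:
  fixes Y :: "'a::euclidean_space set"
  assumes Y: "C1_submanifold m Y" and p: "p \<in> Y" and m: "1 \<le> m"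
  shows "\<exists>\<rho>>0. \<exists>C\<ge>0. \<exists>c\<ge>0. \<forall>x\<in>Y \<inter> ball p \<rho>. \<forall>r. 0 < r \<and> r \<le> \<rho> \<longrightarrow>
     hausdorff_outer m (Y \<inter> ball x r) \<le> ennreal (C * r ^ m) \<and>
     (\<exists>y\<in>Y. 4 * r \<le> dist x y \<and> dist x y \<le> c * r)"
proof -
  obtain W V S and \<Phi> \<Psi> :: "'a \<Rightarrow> 'a" where ch: "p \<in> W" "C1_on W \<Phi>" "C1_on V \<Psi>" "subspace S" "dim S = m"
    "\<And>x. x \<in> W \<Longrightarrow> \<Phi> x \<in> V" "\<And>x. x \<in> W \<Longrightarrow> \<Psi> (\<Phi> x) = x"
    "\<And>z. z \<in> V \<Longrightarrow> \<Psi> z \<in> W" "\<And>z. z \<in> V \<Longrightarrow> \<Phi> (\<Psi> z) = z"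
    "\<And>x. x \<in> Y \<Longrightarrow> x \<in> W \<Longrightarrow> \<Phi> x \<in> S" "\<And>z. z \<in> V \<Longrightarrow> z \<in> S \<Longrightarrow> \<Psi> z \<in> Y"
    by (rule C1_submanifold_chart[OF Y p]) blast
  obtain a A where a: "0 < a" "0 < A" "ball p a \<subseteq> W"
    and A: "\<And>u v. u \<in> ball p a \<Longrightarrow> v \<in> ball p a \<Longrightarrow> dist (\<Phi> u) (\<Phi> v) \<le> A * dist u v"
    by (rule C1_on_locally_lipschitz[OF ch(2,1)]) blast
  obtain b B where b: "0 < b" "0 < B" "ball (\<Phi> p) b \<subseteq> V"
    and B: "\<And>u v. u \<in> ball (\<Phi> p) b \<Longrightarrow> v \<in> ball (\<Phi> p) b \<Longrightarrow> dist (\<Psi> u) (\<Psi> v) \<le> B * dist u v"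
    by (rule C1_on_locally_lipschitz[OF ch(3) ch(6)[OF ch(1)]]) blast
  \<comment> \<open>Positive dimension enters here: \<open>s\<close> is a direction inside
    \<open>S\<close> along which the image of \<open>x\<close> in the chart can be moved
    away.\<close>
  obtain s where s: "s \<in> S" "norm s = 1"
  proof -
    have "dim S \<noteq> 0" using ch(5) m by simp
    moreover have "dim S = 0" if "S \<subseteq> span {}"
      using dim_subset[of S "span {}"] that by (simp only: dim_span) simp
    ultimately obtain w where w: "w \<in> S" "w \<noteq> 0" by auto
    show ?thesis
    proof (rule that)
      show "(1 / norm w) *\<^sub>R w \<in> S" by (rule subspace_scale[OF ch(4) w(1)])
      show "norm ((1 / norm w) *\<^sub>R w) = 1" using w(2) by simp
    qed
  qed
  \<comment> \<open>The bounds keep all points in the balls where the Lipschitz estimates hold. From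
    \<open>A * \<rho> \<le> b / 9\<close> a displacement by \<open>4 * A * r\<close> from
    \<open>\<Phi> x\<close> ends within \<open>5 * b / 9\<close> of \<open>\<Phi> p\<close>; from
    \<open>A * B * \<rho> \<le> a / 9\<close> and \<open>\<rho> \<le> a / 3\<close> its image under
    \<open>\<Psi>\<close> ends within \<open>7 * a / 9\<close> of \<open>p\<close>.\<close>
  define \<rho> where "\<rho> = Min {a / 3, b / (3 * A), b / (9 * A), a / (9 * A * B)}"
  have \<rho>: "0 < \<rho>" "\<rho> \<le> a / 3" "\<rho> \<le> b / (3 * A)" "\<rho> \<le> b / (9 * A)" "\<rho> \<le> a / (9 * A * B)"
    using a b by (auto simp: \<rho>_def)
  have Ar: "A * \<rho> \<le> b / 9" "A * B * \<rho> \<le> a / 9"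
    using \<rho>(4,5) a(2) b(2) by (simp_all add: field_simps)
  have bpos: "\<Phi> u \<in> ball (\<Phi> p) b" if "dist p u < 2 * \<rho>" for u
  proof -
    have "dist (\<Phi> p) (\<Phi> u) \<le> A * dist p u" using that \<rho> a by (intro A) auto
    also have "\<dots> < A * (2 * \<rho>)" using that a by simp
    also have "\<dots> < b" using Ar b by linarith
    finally show ?thesis by simp
  qed
  define C where "C = unit_ball_vol (real m) * (B * (real m * A)) ^ m"
  have C: "0 \<le> C" unfolding C_def using a b by (intro mult_nonneg_nonneg zero_le_power) auto
  have "hausdorff_outer m (Y \<inter> ball x r) \<le> ennreal (C * r ^ m) \<and>
     (\<exists>y\<in>Y. 4 * r \<le> dist x y \<and> dist x y \<le> 4 * A * B * r)"
    if x: "x \<in> Y" "dist p x < \<rho>" and r: "0 < r" "r \<le> \<rho>" for x r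
  proof
    have near: "dist p u < 2 * \<rho>" if "dist x u < r" for u
      using that x r dist_triangle[of p u x] by linarith
    have inW: "u \<in> ball p a" if "dist p u < 2 * \<rho>" for u using that \<rho> a by auto
    let ?D = "\<Phi> ` (Y \<inter> ball x r)"
    have "hausdorff_outer m (\<Psi> ` ?D) \<le> ennreal (unit_ball_vol (real m) * (B * (real m * (A * r))) ^ m)"
    proof (rule hausdorff_outer_lipschitz_subspace_image[OF ch(4,5)])
      show "?D \<subseteq> S" using ch(10) inW near a(3) by force
      show "?D \<subseteq> cball (\<Phi> x) (A * r)"
      proof clarsimp
        fix u assume u: "u \<in> Y" "dist x u < r"
        have "dist (\<Phi> x) (\<Phi> u) \<le> A * dist x u"
          using u near[of u] near[of x] r by (intro A inW) auto
        also have "\<dots> \<le> A * r" using u a by simp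
        finally show "dist (\<Phi> x) (\<Phi> u) \<le> A * r" .
      qed
      show "dist (\<Psi> u) (\<Psi> v) \<le> B * dist u v" if "u \<in> ?D" "v \<in> ?D" for u v
        using that near bpos by (intro B) auto
    qed (use a b r in auto)
    moreover have "\<Psi> ` ?D = Y \<inter> ball x r"
    proof -
      have "\<Psi> (\<Phi> u) = u" if "u \<in> Y \<inter> ball x r" for u
        using that near inW a(3) by (intro ch(7)) auto
      thus ?thesis by (force simp: image_image)
    qed
    ultimately show "hausdorff_outer m (Y \<inter> ball x r) \<le> ennreal (C * r ^ m)"
      by (simp add: C_def power_mult_distrib mult_ac)
    \<comment> \<open>As \<open>\<Phi>\<close> is Lipschitz with constant \<open>A\<close>, a
      displacement by \<open>4 * A * r\<close> in the chart forces a distance of at least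
      \<open>4 * r\<close> in \<open>Y\<close>; as \<open>\<Psi>\<close> is Lipschitz with constant
      \<open>B\<close>, that distance is at most \<open>4 * A * B * r\<close>.\<close>
    define t where "t = 4 * A * r"
    define z where "z = \<Phi> x + t *\<^sub>R s"
    have xp: "x \<in> ball p a" using inW x \<rho> by auto
    hence xW: "x \<in> W" using a by auto
    have t: "0 < t" using a r by (simp add: t_def)
    have dz: "dist (\<Phi> x) z = t" using t s by (simp add: z_def dist_norm)
    have "A * r \<le> A * \<rho>" "A * B * r \<le> A * B * \<rho>" using r a b by simp_all
    hence Ar': "A * r \<le> b / 9" "A * B * r \<le> a / 9" using Ar by linarith+
    have px: "dist (\<Phi> p) (\<Phi> x) \<le> b / 9"
    proof -
      have "dist (\<Phi> p) (\<Phi> x) \<le> A * dist p x" using xp a by (intro A) auto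
      also have "\<dots> \<le> A * \<rho>" using x a by simp
      finally show ?thesis using Ar by linarith
    qed
    have "dist (\<Phi> p) z \<le> b / 9 + 4 * (b / 9)"
      using dist_triangle[of "\<Phi> p" z "\<Phi> x"] dz px Ar' by (simp add: t_def)
    hence zb: "z \<in> ball (\<Phi> p) b" using b by simp
    hence zV: "z \<in> V" using b by auto
    have zS: "z \<in> S" unfolding z_def using ch(4) s ch(10)[OF x(1) xW]
      by (intro subspace_add subspace_scale)
    have xb: "\<Phi> x \<in> ball (\<Phi> p) b" using px b by simp
    have "dist (\<Psi> (\<Phi> x)) (\<Psi> z) \<le> B * dist (\<Phi> x) z" by (intro B xb zb)
    hence up: "dist x (\<Psi> z) \<le> 4 * A * B * r" using dz ch(7)[OF xW] by (simp add: t_def mult_ac)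
    have "dist p (\<Psi> z) \<le> a / 3 + 4 * (a / 9)"
      using dist_triangle[of p "\<Psi> z" x] up Ar' x \<rho> by (simp add: mult_ac)
    hence "\<Psi> z \<in> ball p a" using a by simp
    hence "dist (\<Phi> x) (\<Phi> (\<Psi> z)) \<le> A * dist x (\<Psi> z)" by (intro A xp)
    hence "A * (4 * r) \<le> A * dist x (\<Psi> z)" using dz ch(9)[OF zV] by (simp add: t_def mult_ac)
    hence "4 * r \<le> dist x (\<Psi> z)" using a by simp
    with up ch(11)[OF zV zS] show "\<exists>y\<in>Y. 4 * r \<le> dist x y \<and> dist x y \<le> 4 * A * B * r" by blast
  qed
  thus ?thesis using \<rho>(1) C a b
    by (intro exI[of _ \<rho>] exI[of _ C] exI[of _ "4 * A * B"] conjI ballI) auto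
qed

text \<open>A finite subcover makes the local constants uniform. Sums replace maxima: every constant
  is nonnegative, and the sum is also defined over an empty index set.\<close>

lemma submanifold_regular:
  fixes Y :: "'a::euclidean_space set"
  assumes Y: "C1_submanifold m Y" "compact Y" and m: "1 \<le> m"
  obtains \<rho> C c where "0 < \<rho>" "0 \<le> C" "0 \<le> c"
    "\<And>x r. x \<in> Y \<Longrightarrow> 0 < r \<Longrightarrow> r \<le> \<rho> \<Longrightarrow> hausdorff_outer m (Y \<inter> ball x r) \<le> ennreal (C * r ^ m)"
    "\<And>x r. x \<in> Y \<Longrightarrow> 0 < r \<Longrightarrow> r \<le> \<rho> \<Longrightarrow> \<exists>y\<in>Y. 4 * r \<le> dist x y \<and> dist x y \<le> c * r"
proof -
  obtain \<rho> C c where loc: "\<And>p. p \<in> Y \<Longrightarrow> \<rho> p > 0 \<and> C p \<ge> 0 \<and> c p \<ge> 0 \<and>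
     (\<forall>x\<in>Y \<inter> ball p (\<rho> p). \<forall>r. 0 < r \<and> r \<le> \<rho> p \<longrightarrow>
     hausdorff_outer m (Y \<inter> ball x r) \<le> ennreal (C p * r ^ m) \<and>
     (\<exists>y\<in>Y. 4 * r \<le> dist x y \<and> dist x y \<le> c p * r))"
    using submanifold_regular_local[OF Y(1) _ m] by metis
  obtain D where D: "D \<subseteq> Y" "finite D" "Y \<subseteq> (\<Union>p\<in>D. ball p (\<rho> p))"
    by (rule compactE_image[OF Y(2), of Y "\<lambda>p. ball p (\<rho> p)"]) (use loc in force)+
  \<comment> \<open>The inserted \<open>1\<close> keeps the minimum meaningful when
    \<open>Y\<close>, and with it \<open>D\<close>, is empty.\<close>
  define \<rho>0 where "\<rho>0 = Min (insert 1 (\<rho> ` D))"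
  have \<rho>0: "\<rho>0 \<le> \<rho> p" if "p \<in> D" for p using that D(2) by (simp add: \<rho>0_def)
  have C0: "C p \<le> sum C D" "c p \<le> sum c D" if "p \<in> D" for p
    using that D loc by (auto intro!: member_le_sum)
  show ?thesis
  proof (rule that[of \<rho>0 "sum C D" "sum c D"])
    show "0 < \<rho>0" using D loc by (auto simp: \<rho>0_def)
    show "0 \<le> sum C D" "0 \<le> sum c D" using D loc by (auto intro!: sum_nonneg)
    fix x r assume x: "x \<in> Y" and r: "0 < r" "r \<le> \<rho>0"
    obtain p where p: "p \<in> D" "x \<in> ball p (\<rho> p)" using D x by blast
    have r': "r \<le> \<rho> p" using r \<rho>0 p by force
    have *: "hausdorff_outer m (Y \<inter> ball x r) \<le> ennreal (C p * r ^ m)"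
      "\<exists>y\<in>Y. 4 * r \<le> dist x y \<and> dist x y \<le> c p * r"
      using loc[of p] p D x r r' by auto
    have "ennreal (C p * r ^ m) \<le> ennreal (sum C D * r ^ m)"
      using C0 p r by (intro ennreal_leI mult_right_mono) auto
    thus "hausdorff_outer m (Y \<inter> ball x r) \<le> ennreal (sum C D * r ^ m)" using * by order
    have "c p * r \<le> sum c D * r" using C0 p r by (intro mult_right_mono) auto
    thus "\<exists>y\<in>Y. 4 * r \<le> dist x y \<and> dist x y \<le> sum c D * r" using *(2) by force
  qed
qed

section \<open>The surface measure on a compact submanifold\<close>

lemma space_surface_measure [simp]: "space (surface_measure Y) = Y"
  by (simp add: surface_measure_def space_restrict_space)

lemma sets_surface_measure: "sets (surface_measure Y) = sets (restrict_space borel Y)"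
  unfolding surface_measure_def by (rule sets_restrict_space_cong) simp

lemma emeasure_surface_measure:
  fixes Y :: "(real ^ 'n) set"
  assumes "Y \<in> sets borel" "A \<in> sets borel" "A \<subseteq> Y"
  shows "emeasure (surface_measure Y) A = hausdorff_outer (CARD('n) - 1) A"
  unfolding surface_measure_def
  by (subst emeasure_restrict_space) (use assms in \<open>auto simp: emeasure_hausdorff_measure\<close>)

text \<open>Finitely many balls of radius \<open>\<rho>\<close> cover \<open>Y\<close>. Finiteness
  makes constants integrable, and constants are the only majorants used later.\<close>

lemma finite_surface_measure:
  fixes Y :: "(real ^ 'n) set"
  assumes Y: "compact Y" and \<rho>: "0 < \<rho>"
    and C: "\<And>x r. x \<in> Y \<Longrightarrow> 0 < r \<Longrightarrow> r \<le> \<rho> \<Longrightarrow>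
          hausdorff_outer (CARD('n) - 1) (Y \<inter> ball x r) \<le> ennreal (C * r ^ (CARD('n) - 1))"
  shows "finite_measure (surface_measure Y)"
proof
  let ?M = "surface_measure Y"
  have Yb: "Y \<in> sets borel" using Y by (simp add: borel_compact)
  obtain D where D: "D \<subseteq> Y" "finite D" "Y \<subseteq> (\<Union>p\<in>D. ball p \<rho>)"
    by (rule compactE_image[OF Y, of Y "\<lambda>p. ball p \<rho>"]) (use \<rho> in force)+
  have S: "Y \<inter> ball p \<rho> \<in> sets ?M" for p
    by (auto simp: sets_surface_measure sets_restrict_space)
  have "emeasure ?M Y \<le> emeasure ?M (\<Union>p\<in>D. Y \<inter> ball p \<rho>)"
    using D S by (intro emeasure_mono sets.finite_UN) auto
  also have "\<dots> \<le> (\<Sum>p\<in>D. emeasure ?M (Y \<inter> ball p \<rho>))"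
    using D S by (intro emeasure_subadditive_finite) auto
  also have "\<dots> \<le> (\<Sum>p\<in>D. ennreal (C * \<rho> ^ (CARD('n) - 1)))"
    using D Yb \<rho> C by (intro sum_mono) (auto simp: emeasure_surface_measure)
  also have "\<dots> < \<infinity>" using D by (simp add: ennreal_mult_less_top of_nat_less_top)
  finally show "emeasure ?M (space ?M) \<noteq> \<infinity>" by simp
qed

section \<open>Tangential gradients\<close>

text \<open>Difference quotients are the form in which derivatives are used below: their limits stay
  in closed subspaces and may be taken along sequences.\<close>

lemma has_vector_derivative_quotient:
  assumes "(f has_vector_derivative v) (at a)"
  shows "((\<lambda>h. (f (a + h) - f a) /\<^sub>R h) \<longlongrightarrow> v) (at 0)"
proof -
  have "((\<lambda>h. norm (f (a + h) - f a - h *\<^sub>R v) / norm h) \<longlongrightarrow> 0) (at 0)"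
    using assms unfolding has_vector_derivative_def has_derivative_at by blast
  hence "((\<lambda>h. norm ((f (a + h) - f a) /\<^sub>R h - v)) \<longlongrightarrow> 0) (at 0)"
  proof (rule Lim_transform_eventually)
    have "norm (f (a + h) - f a - h *\<^sub>R v) / norm h = norm ((f (a + h) - f a) /\<^sub>R h - v)" if "h \<noteq> 0" for h
    proof -
      have "(f (a + h) - f a) /\<^sub>R h - v = (f (a + h) - f a - h *\<^sub>R v) /\<^sub>R h"
        using that by (simp add: scaleR_diff_right)
      thus ?thesis by (simp add: divide_inverse_commute)
    qed
    thus "\<forall>\<^sub>F h in at 0. norm (f (a + h) - f a - h *\<^sub>R v) / norm h = norm ((f (a + h) - f a) /\<^sub>R h - v)"
      by (intro eventually_at_topological[THEN iffD2] exI[of _ UNIV]) auto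
  qed
  thus ?thesis by (simp add: tendsto_norm_zero_iff LIM_zero_iff)
qed

text \<open>Velocities of curves have no evident sum. The chart identifies them with the image of
  \<open>S\<close> under the derivative of \<open>\<Psi>\<close> at \<open>\<Phi> x\<close>: a curve
  in \<open>Y\<close> becomes a curve in \<open>S\<close>, and conversely a segment in
  \<open>S\<close> is mapped by \<open>\<Psi>\<close> to a curve in \<open>Y\<close>.\<close>

lemma subspace_tangent_space:
  fixes Y :: "'a::euclidean_space set"
  assumes Y: "C1_submanifold m Y" and x: "x \<in> Y"
  shows "subspace (tangent_space Y x)"
proof -
  obtain W V S and \<Phi> \<Psi> :: "'a \<Rightarrow> 'a" where ch: "x \<in> W" "C1_on W \<Phi>" "C1_on V \<Psi>" "subspace S" "dim S = m"
    "\<And>x. x \<in> W \<Longrightarrow> \<Phi> x \<in> V" "\<And>x. x \<in> W \<Longrightarrow> \<Psi> (\<Phi> x) = x"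
    "\<And>z. z \<in> V \<Longrightarrow> \<Psi> z \<in> W" "\<And>z. z \<in> V \<Longrightarrow> \<Phi> (\<Psi> z) = z"
    "\<And>x. x \<in> Y \<Longrightarrow> x \<in> W \<Longrightarrow> \<Phi> x \<in> S" "\<And>z. z \<in> V \<Longrightarrow> z \<in> S \<Longrightarrow> \<Psi> z \<in> Y"
    by (rule C1_submanifold_chart[OF Y x]) blast
  obtain \<Phi>' where W: "open W" and \<Phi>': "\<And>x. x \<in> W \<Longrightarrow> (\<Phi> has_derivative blinfun_apply (\<Phi>' x)) (at x)"
    using ch(2) unfolding C1_on_def by blast
  obtain \<Psi>' where V: "open V" and \<Psi>'c: "continuous_on V \<Psi>'"
    and \<Psi>': "\<And>x. x \<in> V \<Longrightarrow> (\<Psi> has_derivative blinfun_apply (\<Psi>' x)) (at x)"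
    using ch(3) unfolding C1_on_def by blast
  have zV: "\<Phi> x \<in> V" using ch by blast
  have inv: "blinfun_apply (\<Psi>' (\<Phi> x)) (blinfun_apply (\<Phi>' x) v) = v" for v
  proof -
    have "((\<lambda>u. \<Psi> (\<Phi> u)) has_derivative (\<lambda>v. blinfun_apply (\<Psi>' (\<Phi> x)) (blinfun_apply (\<Phi>' x) v))) (at x)"
      by (rule has_derivative_compose[OF \<Phi>'[OF ch(1)] \<Psi>'[OF zV]])
    hence "((\<lambda>u. u) has_derivative (\<lambda>v. blinfun_apply (\<Psi>' (\<Phi> x)) (blinfun_apply (\<Phi>' x) v))) (at x)"
      by (rule has_derivative_transform_within_open[OF _ W ch(1)]) (simp add: ch)
    from has_derivative_unique[OF this has_derivative_ident] show ?thesis by (rule fun_cong)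
  qed
  have "tangent_space Y x = blinfun_apply (\<Psi>' (\<Phi> x)) ` S"
  proof (intro equalityI subsetI)
    fix v assume "v \<in> tangent_space Y x"
    then obtain e \<gamma> where e: "e > 0" and \<gamma>: "\<gamma> C1_differentiable_on {-e<..<e}" "\<gamma> ` {-e<..<e} \<subseteq> Y"
      "\<gamma> 0 = x" "(\<gamma> has_vector_derivative v) (at 0)" unfolding tangent_space_def by blast
    have "((\<lambda>t. \<Phi> (\<gamma> t)) has_derivative (\<lambda>h. blinfun_apply (\<Phi>' x) (h *\<^sub>R v))) (at 0)"
      using has_derivative_compose[of \<gamma> "\<lambda>h. h *\<^sub>R v" 0 UNIV \<Phi>] \<gamma>(3,4) \<Phi>'[OF ch(1)]
      by (simp add: has_vector_derivative_def)
    hence "((\<lambda>t. \<Phi> (\<gamma> t)) has_vector_derivative blinfun_apply (\<Phi>' x) v) (at 0)"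
      by (simp add: has_vector_derivative_def blinfun.scaleR_right)
    hence lim: "((\<lambda>t. (\<Phi> (\<gamma> t) - \<Phi> x) /\<^sub>R t) \<longlongrightarrow> blinfun_apply (\<Phi>' x) v) (at 0)"
      using has_vector_derivative_quotient[of "\<lambda>t. \<Phi> (\<gamma> t)" _ 0] \<gamma>(3) by simp
    have "isCont \<gamma> 0" using \<gamma>(4) by (rule has_vector_derivative_continuous)
    hence "\<forall>\<^sub>F t in at 0. \<gamma> t \<in> W"
      using topological_tendstoD[of \<gamma> "\<gamma> 0" "at 0" W] W ch(1) \<gamma>(3) by (simp add: isCont_def)
    moreover have "\<forall>\<^sub>F t in at 0. t \<in> {-e<..<e}" using e by (intro eventually_at_in_open') auto
    ultimately have "\<forall>\<^sub>F t in at 0. (\<Phi> (\<gamma> t) - \<Phi> x) /\<^sub>R t \<in> S"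
    proof eventually_elim
      case (elim t)
      hence "\<gamma> t \<in> Y" using \<gamma>(2) by blast
      thus ?case using elim ch(1,4,10) x by (intro subspace_scale subspace_diff) auto
    qed
    \<comment> \<open>A subspace of a Euclidean space is closed, so it contains the limit of the
      difference quotients.\<close>
    hence "blinfun_apply (\<Phi>' x) v \<in> S"
      by (rule Lim_in_closed_set[OF closed_subspace[OF ch(4)] _ _ lim]) simp
    thus "v \<in> blinfun_apply (\<Psi>' (\<Phi> x)) ` S" using inv by (metis imageI)
  next
    fix v assume "v \<in> blinfun_apply (\<Psi>' (\<Phi> x)) ` S"
    then obtain s where s: "s \<in> S" "v = blinfun_apply (\<Psi>' (\<Phi> x)) s" by blast
    obtain r where r: "0 < r" "ball (\<Phi> x) r \<subseteq> V" using V zV by (auto simp: open_contains_ball)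
    define e where "e = r / (norm s + 1)"
    have n: "0 < norm s + 1" by (simp add: add_nonneg_pos)
    have e: "0 < e" using r n by (simp add: e_def)
    define l where "l t = \<Phi> x + t *\<^sub>R s" for t
    have lV: "l t \<in> V" if "t \<in> {-e<..<e}" for t
    proof -
      have "norm (t *\<^sub>R s) \<le> \<bar>t\<bar> * (norm s + 1)" by (simp add: mult_left_mono)
      also have "\<dots> < e * (norm s + 1)" using that n by (intro mult_strict_right_mono) auto
      also have "\<dots> = r" using n by (simp add: e_def)
      finally have "l t \<in> ball (\<Phi> x) r" by (simp add: l_def dist_norm)
      thus ?thesis using r by blast
    qed
    have lS: "l t \<in> S" for t unfolding l_def using s ch(4) ch(10)[OF x ch(1)]
      by (intro subspace_add subspace_scale)
    have der: "((\<lambda>t. \<Psi> (l t)) has_vector_derivative blinfun_apply (\<Psi>' (l t)) s) (at t)"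
      if "t \<in> {-e<..<e}" for t
    proof -
      have "(l has_derivative (\<lambda>h. h *\<^sub>R s)) (at t)" unfolding l_def by (auto intro!: derivative_eq_intros)
      from has_derivative_compose[OF this \<Psi>'[OF lV[OF that]]]
      show ?thesis by (simp add: has_vector_derivative_def blinfun.scaleR_right)
    qed
    have "continuous_on {-e<..<e} (\<lambda>t. blinfun_apply (\<Psi>' (l t)) s)"
      by (intro continuous_intros continuous_on_compose2[OF \<Psi>'c]) (use lV in \<open>auto simp: l_def intro!: continuous_intros\<close>)
    hence "(\<lambda>t. \<Psi> (l t)) C1_differentiable_on {-e<..<e}"
      unfolding C1_differentiable_on_def
      by (intro exI[of _ "\<lambda>t. blinfun_apply (\<Psi>' (l t)) s"] conjI ballI der)
    moreover have "(\<lambda>t. \<Psi> (l t)) ` {-e<..<e} \<subseteq> Y" using lV lS ch(11) by blast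
    moreover have "\<Psi> (l 0) = x" using ch by (simp add: l_def)
    moreover have "((\<lambda>t. \<Psi> (l t)) has_vector_derivative v) (at 0)"
      using der[of 0] e s by (simp add: l_def)
    ultimately show "v \<in> tangent_space Y x"
      unfolding tangent_space_def mem_Collect_eq using e
      by (intro exI[of _ e] exI[of _ "\<lambda>t. \<Psi> (l t)"] conjI)
  qed
  thus ?thesis
    using linear_subspace_image[OF bounded_linear.linear[OF blinfun.bounded_linear_right] ch(4)] by simp
qed

text \<open>Tangent vectors are velocities at parameter \<open>0\<close> on a symmetric interval, so
  the curve is shifted by \<open>t\<close> and restricted to \<open>{-e'<..<e'}\<close>, the largest
  such interval that remains inside.\<close>

lemma has_vector_derivative_tangent_space:
  assumes \<gamma>: "\<gamma> C1_differentiable_on {-e<..<e}" "\<gamma> ` {-e<..<e} \<subseteq> Y" and t: "t \<in> {-e<..<e}"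
    and v: "(\<gamma> has_vector_derivative v) (at t)"
  shows "v \<in> tangent_space Y (\<gamma> t)"
proof -
  obtain D where D: "\<And>s. s \<in> {-e<..<e} \<Longrightarrow> (\<gamma> has_vector_derivative D s) (at s)" "continuous_on {-e<..<e} D"
    using \<gamma>(1) unfolding C1_differentiable_on_def by blast
  define e' where "e' = min (e - t) (e + t)"
  have e': "0 < e'" using t by (auto simp: e'_def)
  have sh: "t + s \<in> {-e<..<e}" if "s \<in> {-e'<..<e'}" for s using that by (auto simp: e'_def)
  have der: "((\<lambda>s. \<gamma> (t + s)) has_vector_derivative w) (at s)"
    if "(\<gamma> has_vector_derivative w) (at (t + s))" for w s
  proof -
    have "((\<lambda>s. t + s) has_derivative (\<lambda>h. h)) (at s)" by (auto intro!: derivative_eq_intros)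
    from has_derivative_compose[OF this that[unfolded has_vector_derivative_def]]
    show ?thesis by (simp add: has_vector_derivative_def)
  qed
  have "(\<lambda>s. \<gamma> (t + s)) C1_differentiable_on {-e'<..<e'}"
    unfolding C1_differentiable_on_def
  proof (intro exI[of _ "\<lambda>s. D (t + s)"] conjI ballI)
    show "continuous_on {-e'<..<e'} (\<lambda>s. D (t + s))"
      by (rule continuous_on_compose2[OF D(2)]) (auto intro!: continuous_intros sh[simplified])
  qed (use D sh der in blast)
  moreover have "(\<lambda>s. \<gamma> (t + s)) ` {-e'<..<e'} \<subseteq> Y" using \<gamma>(2) sh by blast
  moreover have "((\<lambda>s. \<gamma> (t + s)) has_vector_derivative v) (at 0)" using v by (intro der) simp
  moreover have "\<gamma> (t + 0) = \<gamma> t" by simp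
  ultimately show ?thesis unfolding tangent_space_def mem_Collect_eq using e'
    by (intro exI[of _ e'] exI[of _ "\<lambda>s. \<gamma> (t + s)"] conjI)
qed

text \<open>This is the condition under the definite description in
  \<open>tangential_gradient\<close>, as a relation, so that existence and uniqueness can be treated
  separately.\<close>

definition has_tangential_gradient ::
    "(real ^ 'n \<Rightarrow> complex) \<Rightarrow> complex ^ 'n \<Rightarrow> (real ^ 'n) set \<Rightarrow> real ^ 'n \<Rightarrow> bool" where
  "has_tangential_gradient f g Y x \<longleftrightarrow>
     (\<chi> j. Re (g $ j)) \<in> tangent_space Y x \<and> (\<chi> j. Im (g $ j)) \<in> tangent_space Y x \<and>
     (\<exists>D. (f has_derivative D) (at x within Y) \<and>
          (\<forall>v\<in>tangent_space Y x. (\<Sum>j\<in>UNIV. of_real (v $ j) * g $ j) = D v))"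

lemma has_vector_derivative_along_curve:
  fixes f :: "real ^ 'n \<Rightarrow> complex"
  assumes v: "\<gamma> ` {-e<..<e} \<subseteq> Y" "t \<in> {-e<..<e}" "(\<gamma> has_vector_derivative v) (at t)"
    and D: "(f has_derivative D) (at (\<gamma> t) within Y)"
  shows "((\<lambda>s. f (\<gamma> s)) has_vector_derivative D v) (at t)"
proof -
  have "(\<gamma> has_vector_derivative v) (at t within {-e<..<e})"
    using v(3) by (rule has_vector_derivative_at_within)
  from vector_derivative_diff_chain_within[OF this has_derivative_subset[OF D v(1)]]
  have "((\<lambda>s. f (\<gamma> s)) has_vector_derivative D v) (at t within {-e<..<e})" by (simp add: o_def)
  thus ?thesis using v(2) by (subst (asm) at_within_open) auto
qed

text \<open>The derivative \<open>D\<close> within \<open>Y\<close> is not determined on the whole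
  ambient space; its value at the velocity of a curve is, and the gradient gives it. This form of
  the chain rule carries all later uses of gradients.\<close>

lemma has_tangential_gradient_curve:
  assumes f: "has_tangential_gradient f g Y (\<gamma> t)"
    and \<gamma>: "\<gamma> C1_differentiable_on {-e<..<e}" "\<gamma> ` {-e<..<e} \<subseteq> Y" and t: "t \<in> {-e<..<e}"
    and v: "(\<gamma> has_vector_derivative v) (at t)"
  shows "((\<lambda>s. f (\<gamma> s)) has_vector_derivative (\<Sum>j\<in>UNIV. of_real (v $ j) * g $ j)) (at t)"
proof -
  have "v \<in> tangent_space Y (\<gamma> t)" by (rule has_vector_derivative_tangent_space[OF \<gamma> t v])
  thus ?thesis using f has_vector_derivative_along_curve[OF \<gamma>(2) t v] unfolding has_tangential_gradient_def by metis
qed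

text \<open>Testing with \<open>a\<close> and with \<open>b\<close> and subtracting shows that
  \<open>a - b\<close> is orthogonal to itself.\<close>

lemma vec_eq_if_inner_tangent:
  fixes a b :: "'a::real_inner"
  assumes "a \<in> T" "b \<in> T" "\<And>v. v \<in> T \<Longrightarrow> v \<bullet> a = v \<bullet> b"
  shows "a = b"
proof -
  have "(a - b) \<bullet> (a - b) = 0"
    using assms(3)[OF assms(1)] assms(3)[OF assms(2)] by (simp add: algebra_simps inner_commute)
  thus ?thesis by simp
qed

lemma Re_Im_sum_of_real_mult:
  fixes g :: "complex ^ 'n" and v :: "real ^ 'n"
  shows "Re (\<Sum>j\<in>UNIV. of_real (v $ j) * g $ j) = v \<bullet> (\<chi> j. Re (g $ j))"
    "Im (\<Sum>j\<in>UNIV. of_real (v $ j) * g $ j) = v \<bullet> (\<chi> j. Im (g $ j))"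
  by (simp_all add: inner_vec_def)

text \<open>
  Testing with the real and imaginary parts of \<open>g\<close> and \<open>h\<close> themselves suffices.
\<close>

lemma tangential_gradient_eqI:
  assumes curve: "\<And>e \<gamma> v. 0 < e \<Longrightarrow> \<gamma> C1_differentiable_on {-e<..<e} \<Longrightarrow> \<gamma> ` {-e<..<e} \<subseteq> Y \<Longrightarrow> \<gamma> 0 = x \<Longrightarrow>
      (\<gamma> has_vector_derivative v) (at 0) \<Longrightarrow>
      (\<Sum>j\<in>UNIV. of_real (v $ j) * h $ j) = (\<Sum>j\<in>UNIV. of_real (v $ j) * g $ j)"
    and "(\<chi> j. Re (h $ j)) \<in> tangent_space Y x" "(\<chi> j. Im (h $ j)) \<in> tangent_space Y x"
    and "(\<chi> j. Re (g $ j)) \<in> tangent_space Y x" "(\<chi> j. Im (g $ j)) \<in> tangent_space Y x"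
  shows "h = g"
proof -
  have *: "(\<Sum>j\<in>UNIV. of_real (v $ j) * h $ j) = (\<Sum>j\<in>UNIV. of_real (v $ j) * g $ j)"
    if "v \<in> tangent_space Y x" for v
  proof -
    from that obtain e \<gamma> where "0 < e" "\<gamma> C1_differentiable_on {-e<..<e}" "\<gamma> ` {-e<..<e} \<subseteq> Y" "\<gamma> 0 = x"
      "(\<gamma> has_vector_derivative v) (at 0)" unfolding tangent_space_def mem_Collect_eq by (elim exE conjE)
    thus ?thesis by (rule curve)
  qed
  have "(\<chi> j. Re (h $ j)) = (\<chi> j. Re (g $ j))"
    by (rule vec_eq_if_inner_tangent[OF assms(2,4)]) (use arg_cong[OF *, of _ Re] in \<open>simp only: Re_Im_sum_of_real_mult\<close>)
  moreover have "(\<chi> j. Im (h $ j)) = (\<chi> j. Im (g $ j))"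
    by (rule vec_eq_if_inner_tangent[OF assms(3,5)]) (use arg_cong[OF *, of _ Im] in \<open>simp only: Re_Im_sum_of_real_mult\<close>)
  ultimately show ?thesis by (simp add: vec_eq_iff complex_eq_iff)
qed

text \<open>Both pairings with a velocity equal the derivative of \<open>f\<close> along the curve
  at \<open>0\<close>, and a derivative at an interior point of an interval is unique.\<close>

lemma has_tangential_gradient_unique:
  assumes h: "has_tangential_gradient f h Y x" and g: "has_tangential_gradient f g Y x"
  shows "h = g"
proof (rule tangential_gradient_eqI)
  fix e \<gamma> v assume e: "0 < (e::real)" and \<gamma>: "\<gamma> C1_differentiable_on {-e<..<e}" "\<gamma> ` {-e<..<e} \<subseteq> Y" and x: "\<gamma> 0 = x"
    and v: "(\<gamma> has_vector_derivative v) (at 0)"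
  have z: "0 \<in> {-e<..<e}" using e by simp
  show "(\<Sum>j\<in>UNIV. of_real (v $ j) * h $ j) = (\<Sum>j\<in>UNIV. of_real (v $ j) * g $ j)"
    by (rule vector_derivative_unique_at[OF has_tangential_gradient_curve[OF _ \<gamma> z v, of f]
        has_tangential_gradient_curve[OF _ \<gamma> z v]]) (use h g x in auto)
qed (use h g in \<open>auto simp: has_tangential_gradient_def\<close>)

lemma tangential_gradient_eq:
  "has_tangential_gradient f g Y x \<Longrightarrow> tangential_gradient Y f x = g"
  unfolding tangential_gradient_def has_tangential_gradient_def[symmetric]
  by (rule the_equality) (auto intro: has_tangential_gradient_unique)

text \<open>\<open>adjoint L 1\<close> is the Riesz vector of \<open>L\<close> on the whole space;
  its orthogonal projection to \<open>T\<close> represents \<open>L\<close> on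
  \<open>T\<close>.\<close>

lemma tangent_space_functional:
  fixes L :: "'a::euclidean_space \<Rightarrow> real"
  assumes L: "linear L" and T: "subspace T"
  obtains a where "a \<in> T" "\<And>v. v \<in> T \<Longrightarrow> v \<bullet> a = L v"
proof -
  obtain y z where yz: "y \<in> span T" "\<And>w. w \<in> span T \<Longrightarrow> orthogonal z w" "adjoint L 1 = y + z"
    using orthogonal_subspace_decomp_exists[of T "adjoint L 1"] by metis
  have "v \<bullet> y = L v" if "v \<in> T" for v
  proof -
    have "v \<bullet> (y + z) = L v" using adjoint_works[OF L, of v 1] yz(3) by simp
    moreover have "v \<bullet> z = 0" using yz(2)[of v] that by (simp add: span_base orthogonal_def inner_commute)
    ultimately show ?thesis by (simp add: inner_add_right)
  qed
  thus ?thesis using that yz(1) T by (metis span_eq_iff)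
qed

text \<open>The derivative of a local extension is represented on the tangent space by Riesz
  vectors, one for the real and one for the imaginary part. Removing a closed \<open>X\<close>
  serves kernels, which are singular at one point; a small ball around \<open>x\<close> misses
  \<open>X\<close>, so the derivative is one within \<open>Y\<close>.\<close>

lemma C1_on_manifold_has_tangential_gradient:
  fixes f :: "real ^ 'n \<Rightarrow> complex"
  assumes Y: "C1_submanifold m Y" and f: "C1_on_manifold (Y - X) f" and X: "closed X" and x: "x \<in> Y - X"
  shows "has_tangential_gradient f (tangential_gradient Y f x) Y x"
proof -
  from bspec[OF f[unfolded C1_on_manifold_def] x]
  obtain W F where W: "x \<in> W" "C1_on W F" "\<And>z. z \<in> W \<inter> (Y - X) \<Longrightarrow> F z = f z"
    by (elim exE conjE) simp
  from W(2) obtain F' where F': "open W" "\<forall>x\<in>W. (F has_derivative blinfun_apply (F' x)) (at x)"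
    unfolding C1_on_def by (elim exE conjE)
  define D where "D = blinfun_apply (F' x)"
  have D: "open W" "(F has_derivative D) (at x)" using F' W(1) by (auto simp: D_def)
  have "open (W - X)" "x \<in> W - X" using open_Diff[OF D(1) X] W(1) x by auto
  then obtain d where d: "0 < d" "ball x d \<subseteq> W - X" by (auto simp: open_contains_ball)
  have der: "(f has_derivative D) (at x within Y)"
    by (rule has_derivative_transform_within[OF has_derivative_at_withinI[OF D(2)] d(1)])
       (use d x W(3) in \<open>auto simp: dist_commute subset_iff\<close>)
  have T: "subspace (tangent_space Y x)" using subspace_tangent_space[OF Y] x by blast
  have bl: "bounded_linear D" using der by (rule has_derivative_bounded_linear)
  obtain a where a: "a \<in> tangent_space Y x" "\<And>v. v \<in> tangent_space Y x \<Longrightarrow> v \<bullet> a = Re (D v)"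
    by (rule tangent_space_functional[OF bounded_linear.linear[OF bounded_linear_compose[OF bounded_linear_Re bl]] T]) blast
  obtain b where b: "b \<in> tangent_space Y x" "\<And>v. v \<in> tangent_space Y x \<Longrightarrow> v \<bullet> b = Im (D v)"
    by (rule tangent_space_functional[OF bounded_linear.linear[OF bounded_linear_compose[OF bounded_linear_Im bl]] T]) blast
  define g where "g = (\<chi> j. Complex (a $ j) (b $ j))"
  have ab: "(\<chi> j. Re (g $ j)) = a" "(\<chi> j. Im (g $ j)) = b" by (simp_all add: g_def vec_eq_iff)
  have "(\<Sum>j\<in>UNIV. of_real (v $ j) * g $ j) = D v" if "v \<in> tangent_space Y x" for v
    by (rule complex_eqI) (use a(2)[OF that] b(2)[OF that] in \<open>simp_all only: Re_Im_sum_of_real_mult ab\<close>)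
  hence "has_tangential_gradient f g Y x"
    unfolding has_tangential_gradient_def ab using a b der by blast
  thus ?thesis using tangential_gradient_eq by metis
qed

text \<open>Real coefficients act on the real and the imaginary part of a gradient separately, so
  tangency of the two parts is preserved.\<close>

lemma has_tangential_gradient_lincomb:
  fixes f h :: "real ^ 'n \<Rightarrow> complex" and a b :: real
  assumes T: "subspace (tangent_space Y x)" and x: "x \<in> Y"
    and f: "has_tangential_gradient f g Y x" and f': "has_tangential_gradient f' g' Y x"
    and h: "\<And>z. z \<in> Y \<Longrightarrow> h z = of_real a * f z + of_real b * f' z"
  shows "has_tangential_gradient h (a *\<^sub>R g + b *\<^sub>R g') Y x"
proof -
  obtain D where D: "(f has_derivative D) (at x within Y)"
    "\<And>v. v \<in> tangent_space Y x \<Longrightarrow> (\<Sum>j\<in>UNIV. of_real (v $ j) * g $ j) = D v"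
    using f unfolding has_tangential_gradient_def by blast
  obtain D' where D': "(f' has_derivative D') (at x within Y)"
    "\<And>v. v \<in> tangent_space Y x \<Longrightarrow> (\<Sum>j\<in>UNIV. of_real (v $ j) * g' $ j) = D' v"
    using f' unfolding has_tangential_gradient_def by blast
  have "((\<lambda>z. of_real a * f z + of_real b * f' z) has_derivative (\<lambda>v. of_real a * D v + of_real b * D' v)) (at x within Y)"
    using D(1) D'(1) by (auto intro!: derivative_eq_intros)
  hence der: "(h has_derivative (\<lambda>v. of_real a * D v + of_real b * D' v)) (at x within Y)"
    by (rule has_derivative_transform[OF x, rotated]) (use h in auto)
  have c: "(\<chi> j. Re ((a *\<^sub>R g + b *\<^sub>R g') $ j)) = a *\<^sub>R (\<chi> j. Re (g $ j)) + b *\<^sub>R (\<chi> j. Re (g' $ j))"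
    "(\<chi> j. Im ((a *\<^sub>R g + b *\<^sub>R g') $ j)) = a *\<^sub>R (\<chi> j. Im (g $ j)) + b *\<^sub>R (\<chi> j. Im (g' $ j))"
    by (simp_all add: vec_eq_iff)
  have "(\<Sum>j\<in>UNIV. of_real (v $ j) * (a *\<^sub>R g + b *\<^sub>R g') $ j) = of_real a * D v + of_real b * D' v"
    if "v \<in> tangent_space Y x" for v
    using D(2)[OF that, symmetric] D'(2)[OF that, symmetric]
    by (simp add: scaleR_conv_of_real[where 'a=complex] algebra_simps sum.distrib sum_distrib_left)
  moreover have "a *\<^sub>R u + b *\<^sub>R w \<in> tangent_space Y x" if "u \<in> tangent_space Y x" "w \<in> tangent_space Y x" for u w
    using T that by (intro subspace_add subspace_scale)
  ultimately show ?thesis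
    using der f f' unfolding has_tangential_gradient_def c by blast
qed

section \<open>Differentiation under the integral sign\<close>

lemma kernel_class_bound:
  assumes "K \<in> kernel_class s1 s2 s3 Y"
  obtains A where "0 \<le> A" "\<And>x y. x \<in> Y \<Longrightarrow> y \<in> Y \<Longrightarrow> x \<noteq> y \<Longrightarrow> norm (K x y) \<le> A / dist x y powr s1"
proof -
  let ?P = "{(x, y). x \<in> Y \<and> y \<in> Y \<and> x \<noteq> y}"
  define S where "S = (SUP (x, y) \<in> ?P. ennreal (dist x y powr s1 * norm (K x y)))"
  obtain R where R: "S + R < \<infinity>" using assms unfolding kernel_class_def S_def by blast
  have "S < \<infinity>" by (rule order.strict_trans1[OF _ R]) simp
  hence S: "S = ennreal (enn2real S)" by simp
  have "norm (K x y) \<le> enn2real S / dist x y powr s1" if "x \<in> Y" "y \<in> Y" "x \<noteq> y" for x y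
  proof -
    have "ennreal (dist x y powr s1 * norm (K x y)) \<le> S"
      unfolding S_def by (rule SUP_upper2[of "(x, y)"]) (use that in auto)
    hence "dist x y powr s1 * norm (K x y) \<le> enn2real S" by (subst (asm) S) simp
    thus ?thesis using that by (simp add: field_simps)
  qed
  thus ?thesis using that[of "enn2real S"] by simp
qed

lemma kernel_class_continuous:
  assumes "K \<in> kernel_class s1 s2 s3 Y" "x \<in> Y"
  shows "continuous_on (Y - {x}) (K x)"
proof -
  have "continuous_on {(x, y). x \<in> Y \<and> y \<in> Y \<and> x \<noteq> y} (\<lambda>(x, y). K x y)"
    using assms(1) by (simp add: kernel_class_def)
  moreover have "continuous_on (Y - {x}) (\<lambda>y. (x, y))" by (intro continuous_intros)
  ultimately have "continuous_on (Y - {x}) (\<lambda>y. case (x, y) of (x, y) \<Rightarrow> K x y)"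
    by (rule continuous_on_compose2) (use assms(2) in auto)
  thus ?thesis by simp
qed

text \<open>The component of the integral orthogonal to \<open>T\<close> is tested against the
  integral: the inner product passes under the integral sign, where it vanishes.\<close>

lemma integral_in_subspace:
  fixes f :: "'a \<Rightarrow> 'b::euclidean_space"
  assumes T: "subspace T" and f: "integrable M f" "\<And>y. y \<in> space M \<Longrightarrow> f y \<in> T"
  shows "integral\<^sup>L M f \<in> T"
proof -
  obtain u z where uz: "u \<in> span T" "\<And>w. w \<in> span T \<Longrightarrow> orthogonal z w" "integral\<^sup>L M f = u + z"
    using orthogonal_subspace_decomp_exists[of T "integral\<^sup>L M f"] by metis
  have "z \<bullet> integral\<^sup>L M f = (\<integral>y. z \<bullet> f y \<partial>M)" using f(1) by simp
  also have "\<dots> = (\<integral>y. 0 \<partial>M)"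
    by (rule Bochner_Integration.integral_cong) (use uz(2) f(2) in \<open>auto simp: orthogonal_def span_base\<close>)
  finally have "z \<bullet> integral\<^sup>L M f = 0" by simp
  moreover have "z \<bullet> u = 0" using uz by (simp add: orthogonal_def)
  ultimately have "z = 0" by (simp add: uz(3) inner_add_right)
  thus ?thesis using uz T by (simp add: span_eq_iff[THEN iffD2])
qed

lemma norm_integral_le_measure:
  fixes g :: "'a::euclidean_space \<Rightarrow> 'b::{banach,second_countable_topology}"
  assumes M: "finite_measure M" and g: "integrable M g" and E: "E \<in> sets M"
    and b: "\<And>y. y \<in> space M \<Longrightarrow> y \<in> E \<Longrightarrow> norm (g y) \<le> B" "\<And>y. y \<in> space M \<Longrightarrow> y \<notin> E \<Longrightarrow> g y = 0"
  shows "norm (integral\<^sup>L M g) \<le> B * measure M E"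
proof -
  interpret finite_measure M by fact
  have i: "integrable M (indicator E :: 'a \<Rightarrow> real)"
    using E by (intro integrable_real_indicator) (auto simp: less_top[symmetric])
  have "norm (integral\<^sup>L M g) \<le> (\<integral>y. B * indicator E y \<partial>M)"
  proof (rule Bochner_Integration.integral_norm_bound_integral[OF g])
    show "integrable M (\<lambda>y. B * indicator E y)" using i by (rule integrable_mult_right)
    show "norm (g y) \<le> B * indicator E y" if "y \<in> space M" for y
      using b that by (cases "y \<in> E") auto
  qed
  also have "\<dots> = B * measure M E" using E by (simp add: Int_absorb2 sets.sets_into_space)
  finally show ?thesis .
qed

text \<open>Nothing is known of \<open>f\<close> at \<open>x\<close>. Since \<open>\<mu>\<close>
  vanishes near \<open>x\<close>, replacing \<open>f\<close> by its extension by zero from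
  \<open>Y - {x}\<close> leaves the product unchanged on \<open>Y\<close> and makes it
  measurable.\<close>

lemma integrable_surface_off_ball:
  fixes f :: "real ^ 'n \<Rightarrow> 'b::{banach,second_countable_topology}" and \<mu> :: "real ^ 'n \<Rightarrow> real"
  assumes Y: "Y \<in> sets borel" and M: "finite_measure (surface_measure Y)"
    and f: "continuous_on (Y - {x}) f" "\<And>y. y \<in> Y \<Longrightarrow> \<rho> \<le> dist x y \<Longrightarrow> norm (f y) \<le> B"
    and \<mu>: "\<mu> \<in> borel_measurable borel" "\<And>y. \<bar>\<mu> y\<bar> \<le> 1" "\<And>y. dist x y < \<rho> \<Longrightarrow> \<mu> y = 0" and \<rho>: "0 < \<rho>"
  shows "integrable (surface_measure Y) (\<lambda>y. \<mu> y *\<^sub>R f y)"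
proof -
  interpret finite_measure "surface_measure Y" by fact
  have "Y - {x} \<in> sets borel" using Y by simp
  hence "(\<lambda>y. \<mu> y *\<^sub>R (indicator (Y - {x}) y *\<^sub>R f y)) \<in> borel_measurable borel"
    by (intro borel_measurable_scaleR \<mu>(1) borel_measurable_continuous_on_indicator f(1))
  hence "(\<lambda>y. \<mu> y *\<^sub>R (indicator (Y - {x}) y *\<^sub>R f y)) \<in> borel_measurable (restrict_space borel Y)"
    by (rule measurable_restrict_space1)
  hence "(\<lambda>y. \<mu> y *\<^sub>R (indicator (Y - {x}) y *\<^sub>R f y)) \<in> borel_measurable (surface_measure Y)"
    by (simp cong: measurable_cong_sets add: sets_surface_measure)
  hence meas: "(\<lambda>y. \<mu> y *\<^sub>R f y) \<in> borel_measurable (surface_measure Y)"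
    by (rule measurable_cong[THEN iffD1, rotated]) (use \<mu>(3) \<rho> in \<open>auto simp: indicator_def\<close>)
  have "norm (\<mu> y *\<^sub>R f y) \<le> \<bar>B\<bar>" if "y \<in> Y" for y
  proof (cases "dist x y < \<rho>")
    case False
    hence "norm (\<mu> y *\<^sub>R f y) \<le> 1 * norm (f y)" unfolding norm_scaleR using \<mu>(2)
      by (intro mult_right_mono) auto
    thus ?thesis using f(2)[OF that] False by simp
  qed (use \<mu>(3) in simp)
  thus ?thesis using meas by (intro integrable_const_bound[of _ "\<bar>B\<bar>"]) auto
qed

text \<open>These are the facts behind differentiation under the integral sign; rates of decay are
  left to the estimates. The bounds off the diagonal are uniform in both variables because the first
  one moves along a curve.\<close>

locale gradient_kernel =
  fixes Y :: "(real ^ 'n) set" and K :: "real ^ 'n \<Rightarrow> real ^ 'n \<Rightarrow> complex"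
    and G :: "real ^ 'n \<Rightarrow> real ^ 'n \<Rightarrow> complex ^ 'n" and m :: nat
  assumes compact: "compact Y" and submanifold: "C1_submanifold m Y"
    and finite: "finite_measure (surface_measure Y)"
    and K_continuous: "x \<in> Y \<Longrightarrow> continuous_on (Y - {x}) (K x)"
    and K_bounded: "0 < \<rho> \<Longrightarrow> \<exists>B. \<forall>x\<in>Y. \<forall>y\<in>Y. \<rho> \<le> dist x y \<longrightarrow> norm (K x y) \<le> B"
    and G_continuous: "x \<in> Y \<Longrightarrow> continuous_on (Y - {x}) (G x)"
    and G_bounded: "0 < \<rho> \<Longrightarrow> \<exists>B. \<forall>x\<in>Y. \<forall>y\<in>Y. \<rho> \<le> dist x y \<longrightarrow> norm (G x y) \<le> B"
    and gradient: "x \<in> Y \<Longrightarrow> y \<in> Y \<Longrightarrow> x \<noteq> y \<Longrightarrow> has_tangential_gradient (\<lambda>z. K z y) (G x y) Y x"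
begin

lemma borel: "Y \<in> sets borel"
  using compact by (rule borel_compact)

lemma K_integrable:
  assumes "x \<in> Y" "\<mu> \<in> borel_measurable borel" "\<And>y. \<bar>\<mu> y\<bar> \<le> 1" "\<And>y. dist x y < \<rho> \<Longrightarrow> \<mu> y = 0" "0 < \<rho>"
  shows "integrable (surface_measure Y) (\<lambda>y. \<mu> y *\<^sub>R K x y)"
proof -
  obtain B where "\<And>x y. x \<in> Y \<Longrightarrow> y \<in> Y \<Longrightarrow> \<rho> \<le> dist x y \<Longrightarrow> norm (K x y) \<le> B"
    using K_bounded[OF assms(5)] by blast
  with assms show ?thesis
    by (intro integrable_surface_off_ball[OF borel finite K_continuous]) auto
qed

lemma G_integrable:
  assumes "x \<in> Y" "\<mu> \<in> borel_measurable borel" "\<And>y. \<bar>\<mu> y\<bar> \<le> 1" "\<And>y. dist x y < \<rho> \<Longrightarrow> \<mu> y = 0" "0 < \<rho>"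
  shows "integrable (surface_measure Y) (\<lambda>y. \<mu> y *\<^sub>R G x y)"
proof -
  obtain B where "\<And>x y. x \<in> Y \<Longrightarrow> y \<in> Y \<Longrightarrow> \<rho> \<le> dist x y \<Longrightarrow> norm (G x y) \<le> B"
    using G_bounded[OF assms(5)] by blast
  with assms show ?thesis
    by (intro integrable_surface_off_ball[OF borel finite G_continuous]) auto
qed

text \<open>The mean value inequality along the curve yields the majorant for dominated convergence.
  The factor \<open>CARD('n)\<close> comes from estimating the pairing of velocity and gradient term
  by term.\<close>

lemma kernel_difference_le:
  assumes \<gamma>: "\<gamma> C1_differentiable_on {-e<..<e}" "\<gamma> ` {-e<..<e} \<subseteq> Y"
    and D: "\<And>t. t \<in> {-d<..<d} \<Longrightarrow> (\<gamma> has_vector_derivative D t) (at t)"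
      "\<And>t. t \<in> {-d<..<d} \<Longrightarrow> norm (D t) \<le> N"
    and d: "0 < d" "d \<le> e"
    and G: "\<And>t. t \<in> {-d<..<d} \<Longrightarrow> norm (G (\<gamma> t) y) \<le> B" and N: "0 \<le> N" and B: "0 \<le> B"
    and y: "y \<in> Y" "\<And>t. t \<in> {-d<..<d} \<Longrightarrow> \<gamma> t \<noteq> y" and t: "t \<in> {-d<..<d}"
  shows "norm (K (\<gamma> t) y - K (\<gamma> 0) y) \<le> real CARD('n) * (N * B) * \<bar>t\<bar>"
proof -
  define w where "w s = (\<Sum>j\<in>UNIV. of_real (D s $ j) * G (\<gamma> s) y $ j)" for s
  have der: "((\<lambda>s. K (\<gamma> s) y) has_vector_derivative w s) (at s)" if s: "s \<in> {-d<..<d}" for s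
  proof -
    have se: "s \<in> {-e<..<e}" using s d by auto
    hence "\<gamma> s \<in> Y" using \<gamma>(2) by blast
    thus ?thesis unfolding w_def using y s
      by (intro has_tangential_gradient_curve[OF gradient \<gamma> se D(1)]) auto
  qed
  have w: "norm (w s) \<le> real CARD('n) * (N * B)" if s: "s \<in> {-d<..<d}" for s
  proof -
    have "norm (w s) \<le> (\<Sum>j\<in>(UNIV::'n set). N * B)"
      unfolding w_def
    proof (rule sum_norm_le)
      fix j :: 'n
      have "norm (D s $ j) \<le> N" "norm (G (\<gamma> s) y $ j) \<le> B"
        using D(2)[OF s] G[OF s] Finite_Cartesian_Product.norm_nth_le[of "D s" j] Finite_Cartesian_Product.norm_nth_le[of "G (\<gamma> s) y" j] by linarith+
      thus "norm (of_real (D s $ j) * G (\<gamma> s) y $ j) \<le> N * B"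
        unfolding norm_mult using N by (intro mult_mono) auto
    qed
    thus ?thesis by simp
  qed
  have "norm (K (\<gamma> t) y - K (\<gamma> 0) y) \<le> real CARD('n) * (N * B) * norm (t - 0)"
  proof (rule differentiable_bound[where S = "{-d<..<d}" and f' = "\<lambda>s h. h *\<^sub>R w s"])
    fix s assume s: "s \<in> {-d<..<d}"
    show "((\<lambda>s. K (\<gamma> s) y) has_derivative (\<lambda>h. h *\<^sub>R w s)) (at s within {-d<..<d})"
      using der[OF s] unfolding has_vector_derivative_def by (rule has_derivative_at_withinI)
    show "onorm (\<lambda>h. h *\<^sub>R w s) \<le> real CARD('n) * (N * B)"
    proof (rule onorm_bound)
      fix h :: real
      have "\<bar>h\<bar> * norm (w s) \<le> \<bar>h\<bar> * (real CARD('n) * (N * B))"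
        using w[OF s] by (intro mult_left_mono) auto
      thus "norm (h *\<^sub>R w s) \<le> real CARD('n) * (N * B) * norm h" by (simp add: mult_ac)
    qed (use N B in simp)
  qed (use d t in auto)
  thus ?thesis by simp
qed

text \<open>For small parameters the curve stays within \<open>\<rho> / 2\<close> of
  \<open>x\<close>, so points where \<open>\<mu>\<close> is nonzero keep distance
  \<open>\<rho> / 2\<close> from it. There the quotients are bounded by one constant and dominated
  convergence applies.\<close>

lemma integral_difference_quotients:
  fixes \<mu> :: "real ^ 'n \<Rightarrow> real"
  assumes \<mu>: "\<mu> \<in> borel_measurable borel" "\<And>y. \<bar>\<mu> y\<bar> \<le> 1" "\<And>y. dist x y < \<rho> \<Longrightarrow> \<mu> y = 0" and \<rho>: "0 < \<rho>"
    and x: "x \<in> Y" "\<gamma> 0 = x" and e: "0 < (e::real)"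
    and \<gamma>: "\<gamma> C1_differentiable_on {-e<..<e}" "\<gamma> ` {-e<..<e} \<subseteq> Y" and v: "(\<gamma> has_vector_derivative v) (at 0)"
  obtains t :: "nat \<Rightarrow> real" where "t \<longlonglongrightarrow> 0" "\<And>k. t k \<noteq> 0"
    "(\<lambda>k. ((\<integral>y. \<mu> y *\<^sub>R K (\<gamma> (t k)) y \<partial>surface_measure Y) - (\<integral>y. \<mu> y *\<^sub>R K x y \<partial>surface_measure Y)) /\<^sub>R t k)
       \<longlonglongrightarrow> (\<integral>y. \<mu> y *\<^sub>R (\<Sum>j\<in>UNIV. of_real (v $ j) * G x y $ j) \<partial>surface_measure Y)"
proof -
  let ?M = "surface_measure Y"
  interpret finite_measure ?M by (rule finite)
  from \<gamma>(1) obtain D where D: "\<forall>t\<in>{-e<..<e}. (\<gamma> has_vector_derivative D t) (at t)" "continuous_on {-e<..<e} D"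
    unfolding C1_differentiable_on_def by (elim exE conjE)
  have z: "0 \<in> {-e<..<e}" using e by simp
  obtain d1 where d1: "0 < d1" "\<And>t. t \<in> {-e<..<e} \<Longrightarrow> dist t 0 < d1 \<Longrightarrow> dist (D t) (D 0) < 1"
    using D(2) z unfolding continuous_on_iff by (metis zero_less_one)
  have "isCont \<gamma> 0" using v by (rule has_vector_derivative_continuous)
  then obtain d2 where d2: "0 < d2" "\<And>t. dist t 0 < d2 \<Longrightarrow> dist (\<gamma> t) (\<gamma> 0) < \<rho> / 2"
    unfolding continuous_at_eps_delta dist_norm using \<rho> by (metis half_gt_zero)
  \<comment> \<open>On \<open>{-d<..<d}\<close> the velocity is within \<open>1\<close> of its value
    at \<open>0\<close>, which gives the bound \<open>N\<close>, and the curve is within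
    \<open>\<rho> / 2\<close> of \<open>x\<close>.\<close>
  define d where "d = min e (min d1 d2)"
  have d: "0 < d" "d \<le> e" using e d1 d2 by (auto simp: d_def)
  define N where "N = norm (D 0) + 1"
  have N: "0 \<le> N" by (simp add: N_def)
  have DN: "norm (D t) \<le> N" if "t \<in> {-d<..<d}" for t
  proof -
    have "dist (D t) (D 0) < 1" using that d by (intro d1) (auto simp: d_def)
    thus ?thesis unfolding N_def dist_norm by norm
  qed
  have near: "dist x (\<gamma> t) < \<rho> / 2" if "t \<in> {-d<..<d}" for t
    using d2(2)[of t] that x by (auto simp: d_def dist_commute)
  have \<gamma>Y: "\<gamma> t \<in> Y" if "t \<in> {-d<..<d}" for t
  proof -
    have "t \<in> {-e<..<e}" using that d by auto
    thus ?thesis using \<gamma>(2) by blast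
  qed
  have far: "\<rho> / 2 \<le> dist (\<gamma> t) y" if "\<rho> \<le> dist x y" "t \<in> {-d<..<d}" for t y
    using near[OF that(2)] that(1) dist_triangle[of x y "\<gamma> t"] by linarith
  have van: "\<mu> y = 0" if "dist (\<gamma> t) y < \<rho> / 2" "t \<in> {-d<..<d}" for t y
    using far[of y t] that \<mu>(3)[of y] by linarith
  obtain B where B: "\<And>x y. x \<in> Y \<Longrightarrow> y \<in> Y \<Longrightarrow> \<rho> / 2 \<le> dist x y \<Longrightarrow> norm (G x y) \<le> B"
    using G_bounded[of "\<rho> / 2"] \<rho> by auto
  \<comment> \<open>The shift by \<open>2\<close> keeps the first term strictly below
    \<open>d\<close>, inside the open interval.\<close>
  define t where "t k = d / real (k + 2)" for k
  have t: "t k \<in> {-d<..<d}" "t k \<noteq> 0" for k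
  proof -
    have "d / real (k + 2) < d / 1" using d by (intro divide_strict_left_mono) auto
    thus "t k \<in> {-d<..<d}" "t k \<noteq> 0" using d by (auto simp: t_def intro: order.strict_trans[of _ 0])
  qed
  have t0: "t \<longlonglongrightarrow> 0" unfolding t_def by (rule LIMSEQ_ignore_initial_segment[OF lim_const_over_n])
  let ?s = "\<lambda>k y. (\<mu> y *\<^sub>R K (\<gamma> (t k)) y - \<mu> y *\<^sub>R K x y) /\<^sub>R t k"
  let ?f = "\<lambda>y. \<mu> y *\<^sub>R (\<Sum>j\<in>UNIV. of_real (v $ j) * G x y $ j)"
  let ?w = "real CARD('n) * (N * \<bar>B\<bar>)"
  have iK: "integrable ?M (\<lambda>y. \<mu> y *\<^sub>R K (\<gamma> (t k)) y)" for k
    using t van \<rho> by (intro K_integrable[OF \<gamma>Y \<mu>(1,2), of _ "\<rho> / 2"]) auto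
  have iK0: "integrable ?M (\<lambda>y. \<mu> y *\<^sub>R K x y)" by (rule K_integrable[OF x(1) \<mu> \<rho>])
  have bl: "bounded_linear (\<lambda>g::complex^'n. \<Sum>j\<in>UNIV. of_real (v $ j) * g $ j)"
    by (intro linear_conv_bounded_linear[THEN iffD1] linearI)
       (auto simp: algebra_simps sum.distrib scaleR_sum_right)
  have lin: "(\<Sum>j\<in>UNIV. of_real (v $ j) * (\<mu> y *\<^sub>R G x y) $ j) = ?f y" for y
    using linear_cmul[OF bounded_linear.linear[OF bl], of "\<mu> y" "G x y"] by simp
  have iG: "integrable ?M ?f"
    using integrable_bounded_linear[OF bl G_integrable[OF x(1) \<mu> \<rho>]] unfolding lin .
  have "(\<lambda>k. integral\<^sup>L ?M (?s k)) \<longlonglongrightarrow> integral\<^sup>L ?M ?f"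
  proof (rule integral_dominated_convergence[where w = "\<lambda>_. ?w"])
    show "?f \<in> borel_measurable ?M" using iG by (rule borel_measurable_integrable)
    show "?s k \<in> borel_measurable ?M" for k using borel_measurable_integrable[OF iK[of k]] borel_measurable_integrable[OF iK0] by measurable
    show "integrable ?M (\<lambda>_. ?w)" by simp
    show "AE y in ?M. (\<lambda>k. ?s k y) \<longlonglongrightarrow> ?f y"
    proof (rule AE_I2)
      fix y assume "y \<in> space ?M"
      hence y: "y \<in> Y" by simp
      show "(\<lambda>k. ?s k y) \<longlonglongrightarrow> ?f y"
      proof (cases "dist x y < \<rho>")
        case True thus ?thesis by (simp add: \<mu>(3))
      next
        case False
        hence "x \<noteq> y" using \<rho> by auto
        hence "has_tangential_gradient (\<lambda>z. K z y) (G x y) Y (\<gamma> 0)" using gradient x y by simp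
        from has_vector_derivative_quotient[OF has_tangential_gradient_curve[OF this \<gamma> z v]]
        have "((\<lambda>h. (K (\<gamma> h) y - K x y) /\<^sub>R h) \<longlongrightarrow> (\<Sum>j\<in>UNIV. of_real (v $ j) * G x y $ j)) (at 0)"
          using x by simp
        hence "(\<lambda>k. (K (\<gamma> (t k)) y - K x y) /\<^sub>R t k) \<longlonglongrightarrow> (\<Sum>j\<in>UNIV. of_real (v $ j) * G x y $ j)"
          by (rule filterlim_compose) (use t t0 in \<open>auto simp: filterlim_at\<close>)
        hence "(\<lambda>k. \<mu> y *\<^sub>R ((K (\<gamma> (t k)) y - K x y) /\<^sub>R t k)) \<longlonglongrightarrow> ?f y"
          by (intro tendsto_intros)
        thus ?thesis by (simp add: scaleR_diff_right mult.commute)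
      qed
    qed
    show "AE y in ?M. norm (?s k y) \<le> ?w" for k
    proof (rule AE_I2)
      fix y assume "y \<in> space ?M"
      hence y: "y \<in> Y" by simp
      show "norm (?s k y) \<le> ?w"
      proof (cases "dist x y < \<rho>")
        case True thus ?thesis using N by (simp add: \<mu>(3))
      next
        case False
        have "norm (K (\<gamma> (t k)) y - K (\<gamma> 0) y) \<le> ?w * \<bar>t k\<bar>"
        proof (rule kernel_difference_le[OF \<gamma> _ DN d _ N _ y _ t(1)])
          fix s assume s: "s \<in> {-d<..<d}"
          show "(\<gamma> has_vector_derivative D s) (at s)" using s d by (intro D(1)[rule_format]) auto
          have f: "\<rho> / 2 \<le> dist (\<gamma> s) y" using False s by (intro far) auto
          have "norm (G (\<gamma> s) y) \<le> B" using B[OF \<gamma>Y[OF s] y f] .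
          thus "norm (G (\<gamma> s) y) \<le> \<bar>B\<bar>" by simp
          show "\<gamma> s \<noteq> y" using f \<rho> by auto
        qed auto
        hence "norm (K (\<gamma> (t k)) y - K x y) / \<bar>t k\<bar> \<le> ?w"
          using t x by (simp add: divide_le_eq)
        moreover have "norm (?s k y) = \<bar>\<mu> y\<bar> * (norm (K (\<gamma> (t k)) y - K x y) / \<bar>t k\<bar>)"
          unfolding scaleR_diff_right[symmetric] by (simp add: divide_inverse abs_mult mult_ac)
        moreover have "\<dots> \<le> 1 * (norm (K (\<gamma> (t k)) y - K x y) / \<bar>t k\<bar>)"
          using \<mu>(2) by (intro mult_right_mono) auto
        ultimately show ?thesis by linarith
      qed
    qed
  qed
  moreover have "integral\<^sup>L ?M (?s k) =
      ((\<integral>y. \<mu> y *\<^sub>R K (\<gamma> (t k)) y \<partial>?M) - (\<integral>y. \<mu> y *\<^sub>R K x y \<partial>?M)) /\<^sub>R t k" for k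
    using iK iK0 by simp
  ultimately have "(\<lambda>k. ((\<integral>y. \<mu> y *\<^sub>R K (\<gamma> (t k)) y \<partial>?M) - (\<integral>y. \<mu> y *\<^sub>R K x y \<partial>?M)) /\<^sub>R t k)
       \<longlonglongrightarrow> integral\<^sup>L ?M ?f" by (simp only:)
  from that[OF t0 t(2) this] show ?thesis .
qed

text \<open>That the integral has some gradient \<open>g\<close> is assumed; along every curve the
  limit of one sequence of difference quotients then determines its pairing with the velocity.
  Equality follows once the integral of \<open>G\<close> is seen to have tangent real and imaginary
  parts.\<close>

lemma gradient_integral:
  fixes \<mu> :: "real ^ 'n \<Rightarrow> real"
  assumes \<mu>: "\<mu> \<in> borel_measurable borel" "\<And>y. \<bar>\<mu> y\<bar> \<le> 1" "\<And>y. dist x y < \<rho> \<Longrightarrow> \<mu> y = 0" and \<rho>: "0 < \<rho>"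
    and x: "x \<in> Y"
    and g: "has_tangential_gradient (\<lambda>x. \<integral>y. \<mu> y *\<^sub>R K x y \<partial>surface_measure Y) g Y x"
  shows "g = (\<integral>y. \<mu> y *\<^sub>R G x y \<partial>surface_measure Y)"
proof -
  let ?M = "surface_measure Y" and ?F = "\<lambda>x. \<integral>y. \<mu> y *\<^sub>R K x y \<partial>surface_measure Y"
  have iG: "integrable ?M (\<lambda>y. \<mu> y *\<^sub>R G x y)" by (rule G_integrable[OF x \<mu> \<rho>])
  have T: "subspace (tangent_space Y x)" by (rule subspace_tangent_space[OF submanifold x])
  have inT: "P (integral\<^sup>L ?M (\<lambda>y. \<mu> y *\<^sub>R G x y)) \<in> tangent_space Y x"
    if P: "bounded_linear P" and PG: "\<And>y. y \<in> Y \<Longrightarrow> x \<noteq> y \<Longrightarrow> P (G x y) \<in> tangent_space Y x" for P :: "complex^'n \<Rightarrow> real^'n"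
  proof -
    have "P (\<mu> y *\<^sub>R G x y) \<in> tangent_space Y x" if y: "y \<in> Y" for y
    proof (cases "x = y")
      \<comment> \<open>Tangency of \<open>G x y\<close> is known for \<open>y \<noteq> x\<close>
        only; at \<open>y = x\<close> the weight vanishes.\<close>
      case True
      hence "\<mu> y = 0" using \<mu>(3) \<rho> by simp
      thus ?thesis using T P by (simp add: linear_0 bounded_linear.linear subspace_0)
    next
      case False
      have "P (\<mu> y *\<^sub>R G x y) = \<mu> y *\<^sub>R P (G x y)" by (rule linear_cmul[OF bounded_linear.linear[OF P]])
      thus ?thesis using subspace_scale[OF T PG[OF y False]] by simp
    qed
    hence "(\<integral>y. P (\<mu> y *\<^sub>R G x y) \<partial>?M) \<in> tangent_space Y x"
      by (intro integral_in_subspace[OF T] integrable_bounded_linear[OF P iG]) auto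
    thus ?thesis by (simp add: integral_bounded_linear[OF P iG])
  qed
  have P: "bounded_linear (\<lambda>g::complex^'n. \<chi> j. Re (g $ j))" "bounded_linear (\<lambda>g::complex^'n. \<chi> j. Im (g $ j))"
    by (auto intro!: linear_conv_bounded_linear[THEN iffD1] linearI simp: vec_eq_iff)
  show ?thesis
  proof (rule tangential_gradient_eqI)
    show "(\<chi> j. Re ((\<integral>y. \<mu> y *\<^sub>R G x y \<partial>?M) $ j)) \<in> tangent_space Y x"
      by (rule inT[OF P(1)]) (use gradient x in \<open>auto simp: has_tangential_gradient_def\<close>)
    show "(\<chi> j. Im ((\<integral>y. \<mu> y *\<^sub>R G x y \<partial>?M) $ j)) \<in> tangent_space Y x"
      by (rule inT[OF P(2)]) (use gradient x in \<open>auto simp: has_tangential_gradient_def\<close>)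
    fix e :: real and \<gamma> v
    assume e: "0 < e" and \<gamma>: "\<gamma> C1_differentiable_on {-e<..<e}" "\<gamma> ` {-e<..<e} \<subseteq> Y" and x0: "\<gamma> 0 = x"
      and v: "(\<gamma> has_vector_derivative v) (at 0)"
    have z: "0 \<in> {-e<..<e}" using e by simp
    obtain t :: "nat \<Rightarrow> real" where t: "t \<longlonglongrightarrow> 0" "\<And>k. t k \<noteq> 0"
      and lim: "(\<lambda>k. (?F (\<gamma> (t k)) - ?F x) /\<^sub>R t k)
         \<longlonglongrightarrow> (\<integral>y. \<mu> y *\<^sub>R (\<Sum>j\<in>UNIV. of_real (v $ j) * G x y $ j) \<partial>?M)"
      by (rule integral_difference_quotients[OF \<mu> \<rho> x x0 e \<gamma> v]) (assumption | rule that)+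
    have "((\<lambda>s. ?F (\<gamma> s)) has_vector_derivative (\<Sum>j\<in>UNIV. of_real (v $ j) * g $ j)) (at 0)"
      using g x0 by (intro has_tangential_gradient_curve[OF _ \<gamma> z v]) simp
    from has_vector_derivative_quotient[OF this]
    have "((\<lambda>h. (?F (\<gamma> h) - ?F x) /\<^sub>R h) \<longlongrightarrow> (\<Sum>j\<in>UNIV. of_real (v $ j) * g $ j)) (at 0)"
      using x0 by simp
    hence "(\<lambda>k. (?F (\<gamma> (t k)) - ?F x) /\<^sub>R t k) \<longlonglongrightarrow> (\<Sum>j\<in>UNIV. of_real (v $ j) * g $ j)"
      by (rule filterlim_compose) (use t in \<open>auto simp: filterlim_at\<close>)
    from LIMSEQ_unique[OF this lim]
    have "(\<Sum>j\<in>UNIV. of_real (v $ j) * g $ j) = (\<integral>y. \<mu> y *\<^sub>R (\<Sum>j\<in>UNIV. of_real (v $ j) * G x y $ j) \<partial>?M)" .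
    also have "\<dots> = (\<integral>y. (\<Sum>j\<in>UNIV. of_real (v $ j) * (\<mu> y *\<^sub>R G x y) $ j) \<partial>?M)"
      by (simp add: scaleR_sum_right)
    also have "\<dots> = (\<Sum>j\<in>UNIV. of_real (v $ j) * (\<integral>y. \<mu> y *\<^sub>R G x y \<partial>?M) $ j)"
      by (intro integral_bounded_linear[OF _ iG] linear_conv_bounded_linear[THEN iffD1] linearI)
         (auto simp: algebra_simps sum.distrib scaleR_sum_right)
    finally show "(\<Sum>j\<in>UNIV. of_real (v $ j) * g $ j) = (\<Sum>j\<in>UNIV. of_real (v $ j) * (\<integral>y. \<mu> y *\<^sub>R G x y \<partial>?M) $ j)" .
  qed (use g in \<open>auto simp: has_tangential_gradient_def\<close>)
qed

end

section \<open>Truncated integrals of the gradient kernel\<close>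

text \<open>One estimate, size of the weight times size of the kernel at distance \<open>d\<close>
  times measure of the support, serves the cutoff seen from the remote point, the annulus, and large
  radii.\<close>

lemma (in gradient_kernel) norm_integral_G_le:
  assumes x: "x \<in> Y" and \<mu>: "\<mu> \<in> borel_measurable borel" "\<And>y. \<bar>\<mu> y\<bar> \<le> k" "\<And>y. dist x y < d \<Longrightarrow> \<mu> y = 0"
    and d: "0 < d" and k: "k \<le> 1" and A: "0 \<le> A"
    and G: "\<And>y. y \<in> Y \<Longrightarrow> x \<noteq> y \<Longrightarrow> norm (G x y) \<le> A / dist x y ^ p"
    and E: "E \<in> sets (surface_measure Y)" "\<And>y. y \<in> Y \<Longrightarrow> y \<notin> E \<Longrightarrow> \<mu> y = 0"
  shows "norm (\<integral>y. \<mu> y *\<^sub>R G x y \<partial>surface_measure Y) \<le> k * (A / d ^ p) * measure (surface_measure Y) E"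
proof (rule norm_integral_le_measure[OF finite _ E(1)])
  have "\<bar>\<mu> y\<bar> \<le> 1" for y using \<mu>(2)[of y] k by linarith
  thus "integrable (surface_measure Y) (\<lambda>y. \<mu> y *\<^sub>R G x y)"
    by (rule G_integrable[OF x \<mu>(1) _ \<mu>(3) d])
  have k0: "0 \<le> k" using \<mu>(2)[of x] by linarith
  show "norm (\<mu> y *\<^sub>R G x y) \<le> k * (A / d ^ p)" if y: "y \<in> space (surface_measure Y)" for y
  proof (cases "dist x y < d")
    case True
    thus ?thesis using k0 A d by (simp add: \<mu>(3))
  next
    case False
    hence "A / dist x y ^ p \<le> A / d ^ p" using A d by (intro divide_left_mono power_mono mult_pos_pos zero_less_power) auto
    moreover have "norm (G x y) \<le> A / dist x y ^ p" using y False d by (intro G) auto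
    ultimately have "norm (G x y) \<le> A / d ^ p" by linarith
    thus ?thesis unfolding norm_scaleR using \<mu>(2) k0 by (intro mult_mono) auto
  qed
  show "\<mu> y *\<^sub>R G x y = 0" if "y \<in> space (surface_measure Y)" "y \<notin> E" for y using E(2) that by simp
qed

section \<open>Hoelder norms, cutoffs, and the operator near zero\<close>

lemma holder_norm_le:
  assumes "\<And>x. x \<in> Y \<Longrightarrow> norm (f x) \<le> a" "0 \<le> a" "0 \<le> b"
    "\<And>x y. x \<in> Y \<Longrightarrow> y \<in> Y \<Longrightarrow> norm (f x - f y) \<le> b * dist x y powr \<beta>"
  shows "holder_norm \<beta> Y f \<le> ennreal (a + b)"
proof -
  have "sup_norm_on Y f \<le> ennreal a"
    unfolding sup_norm_on_def using assms(1) by (intro SUP_least ennreal_leI)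
  moreover have "(SUP (x, y) \<in> {(x, y). x \<in> Y \<and> y \<in> Y \<and> x \<noteq> y}. ennreal (norm (f x - f y) / dist x y powr \<beta>)) \<le> ennreal b"
    using assms(4) by (intro SUP_least) (auto intro!: ennreal_leI simp: divide_le_eq)
  ultimately show ?thesis
    unfolding holder_norm_def using assms(2,3) by (simp add: add_mono)
qed

lemma holder_norm_bounds:
  assumes H: "holder_norm \<beta> Y f \<le> ennreal H" "0 \<le> H" and x: "x \<in> Y"
  shows "norm (f x) \<le> H" and "y \<in> Y \<Longrightarrow> norm (f x - f y) \<le> H * dist x y powr \<beta>"
proof -
  let ?S = "SUP (x, y) \<in> {(x, y). x \<in> Y \<and> y \<in> Y \<and> x \<noteq> y}. ennreal (norm (f x - f y) / dist x y powr \<beta>)"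
  have "ennreal (norm (f x)) \<le> sup_norm_on Y f" unfolding sup_norm_on_def using x by (intro SUP_upper)
  also have "\<dots> \<le> holder_norm \<beta> Y f" unfolding holder_norm_def by simp
  also have "\<dots> \<le> ennreal H" by (rule H)
  finally show "norm (f x) \<le> H" using H by simp
  show "norm (f x - f y) \<le> H * dist x y powr \<beta>" if y: "y \<in> Y"
  proof (cases "x = y")
    case False
    have "ennreal (norm (f x - f y) / dist x y powr \<beta>) \<le> ?S"
      by (rule SUP_upper2[of "(x, y)"]) (use x y False in auto)
    also have "\<dots> \<le> holder_norm \<beta> Y f" unfolding holder_norm_def by simp
    also have "\<dots> \<le> ennreal H" by (rule H)
    finally have "norm (f x - f y) / dist x y powr \<beta> \<le> H" using H by simp
    thus ?thesis using False by (simp add: divide_le_eq)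
  qed simp
qed

definition bump :: "'a::metric_space \<Rightarrow> real \<Rightarrow> 'a \<Rightarrow> real" where
  "bump x r y = max 0 (min 1 (2 - dist x y / r))"

lemma bump_nonneg: "0 \<le> bump x r y" and bump_le_1: "bump x r y \<le> 1"
  by (simp_all add: bump_def)

lemma bump_eq_1: "0 < r \<Longrightarrow> dist x y \<le> r \<Longrightarrow> bump x r y = 1"
  by (simp add: bump_def field_simps)

lemma bump_eq_0: "0 < r \<Longrightarrow> 2 * r \<le> dist x y \<Longrightarrow> bump x r y = 0"
  by (simp add: bump_def field_simps)

lemma bump_measurable [measurable]: "bump x r \<in> borel_measurable borel"
  unfolding bump_def divide_inverse by (intro borel_measurable_continuous_onI continuous_intros)

text \<open>Interpolates between a bound on values and a Lipschitz bound, the exponents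
  \<open>0\<close> and \<open>1\<close>.\<close>

lemma min_one_le_powr:
  fixes s :: real
  assumes "0 \<le> s" "0 < \<beta>" "\<beta> \<le> 1"
  shows "min 1 s \<le> s powr \<beta>"
proof (cases "s \<le> 1")
  case True
  thus ?thesis using powr_mono'[of \<beta> 1 s] assms by simp
next
  case False
  thus ?thesis using ge_one_powr_ge_zero[of s \<beta>] assms by simp
qed

text \<open>Clamping to the unit interval does not increase differences, so the cutoff is Lipschitz
  with constant \<open>1 / r\<close>; its oscillation is also at most \<open>1\<close>.\<close>

lemma bump_holder:
  assumes r: "0 < r" and \<beta>: "0 < \<beta>" "\<beta> \<le> 1"
  shows "\<bar>bump x r y - bump x r z\<bar> \<le> (1 / r powr \<beta>) * dist y z powr \<beta>"
proof -
  have "\<bar>dist x y / r - dist x z / r\<bar> \<le> dist y z / r"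
    using abs_dist_diff_le[of y x z] r
    by (simp add: dist_commute diff_divide_distrib[symmetric] divide_right_mono)
  hence "\<bar>bump x r y - bump x r z\<bar> \<le> min 1 (dist y z / r)" unfolding bump_def by linarith
  also have "\<dots> \<le> (dist y z / r) powr \<beta>" using r \<beta> by (intro min_one_le_powr) auto
  also have "\<dots> = (1 / r powr \<beta>) * dist y z powr \<beta>" using r by (simp add: powr_divide)
  finally show ?thesis .
qed

lemma integral_operator_of_real:
  "integral_operator Y K (\<lambda>y. complex_of_real (\<mu> y)) x = (\<integral>y. \<mu> y *\<^sub>R K x y \<partial>surface_measure Y)"
  by (simp add: integral_operator_def scaleR_conv_of_real mult.commute)

text \<open>The image of zero is assumed to vanish everywhere, also off \<open>Y\<close>:
  \<open>NG\<close> is applied to functions on the whole type, whereas linearity of \<open>T\<close>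
  is an identity on \<open>Y\<close> only.\<close>

lemma linear_continuous_map_bounded_at_0:
  assumes T: "linear_continuous_map Y E NE G NG T" and 0: "(\<lambda>_. 0) \<in> E" "\<And>x. T (\<lambda>_. 0) x = 0"
  obtains \<delta> where "0 < \<delta>" "\<And>\<nu>. \<nu> \<in> E \<Longrightarrow> NE \<nu> < ennreal \<delta> \<Longrightarrow> NG (T \<nu>) < 1"
proof -
  have *: "\<forall>\<mu>\<in>E. \<forall>\<epsilon>>0. \<exists>\<delta>>0. \<forall>\<nu>\<in>E.
      NE (\<lambda>y. \<nu> y - \<mu> y) < ennreal \<delta> \<longrightarrow> NG (\<lambda>x. T \<nu> x - T \<mu> x) < ennreal \<epsilon>"
    using T unfolding linear_continuous_map_def by (elim conjE)
  obtain \<delta> where \<delta>: "0 < \<delta>"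
    "\<forall>\<nu>\<in>E. NE (\<lambda>y. \<nu> y - 0) < ennreal \<delta> \<longrightarrow> NG (\<lambda>x. T \<nu> x - T (\<lambda>_. 0) x) < ennreal 1"
    using *[rule_format, OF 0(1) zero_less_one] by (elim exE conjE)
  show ?thesis
  proof (rule that[OF \<delta>(1)])
    fix \<nu> assume "\<nu> \<in> E" "NE \<nu> < ennreal \<delta>"
    thus "NG (T \<nu>) < 1" using bspec[OF \<delta>(2), of \<nu>] 0(2) by simp
  qed
qed

lemma kernel_class_bound_off_diagonal:
  assumes A: "0 \<le> A" "\<And>x y. x \<in> Y \<Longrightarrow> y \<in> Y \<Longrightarrow> x \<noteq> y \<Longrightarrow> norm (f x y) \<le> A / dist x y powr s"
    and s: "0 \<le> s" and \<rho>: "0 < \<rho>"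
  shows "\<exists>B. \<forall>x\<in>Y. \<forall>y\<in>Y. \<rho> \<le> dist x y \<longrightarrow> norm (f x y) \<le> B"
proof (intro exI ballI impI)
  fix x y assume xy: "x \<in> Y" "y \<in> Y" "\<rho> \<le> dist x y"
  have "norm (f x y) \<le> A / dist x y powr s" using xy \<rho> by (intro A(2)) auto
  also have "\<dots> \<le> A / \<rho> powr s"
    using A(1) \<rho> s xy by (intro divide_left_mono powr_mono2 mult_pos_pos) auto
  finally show "norm (f x y) \<le> A / \<rho> powr s" .
qed

lemma kernel_class_vec_bound:
  fixes G :: "'a::metric_space \<Rightarrow> 'a \<Rightarrow> complex ^ 'n"
  assumes "\<And>j. (\<lambda>x y. G x y $ j) \<in> kernel_class t1 t2 t3 Y"
  obtains A where "0 \<le> A" "\<And>x y. x \<in> Y \<Longrightarrow> y \<in> Y \<Longrightarrow> x \<noteq> y \<Longrightarrow> norm (G x y) \<le> A / dist x y powr t1"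
proof -
  have "\<exists>a\<ge>0. \<forall>x\<in>Y. \<forall>y\<in>Y. x \<noteq> y \<longrightarrow> norm (G x y $ j) \<le> a / dist x y powr t1" for j
    by (rule kernel_class_bound[OF assms[of j]]) blast
  then obtain a where a: "\<And>j. 0 \<le> a j"
    "\<And>j x y. x \<in> Y \<Longrightarrow> y \<in> Y \<Longrightarrow> x \<noteq> y \<Longrightarrow> norm (G x y $ j) \<le> a j / dist x y powr t1"
    by metis
  have "norm (G x y) \<le> (\<Sum>j\<in>UNIV. a j) / dist x y powr t1" if "x \<in> Y" "y \<in> Y" "x \<noteq> y" for x y
  proof -
    have "norm (G x y) \<le> (\<Sum>j\<in>UNIV. norm (G x y $ j))" unfolding norm_vec_def by (rule L2_set_le_sum) simp
    also have "\<dots> \<le> (\<Sum>j\<in>UNIV. a j / dist x y powr t1)" using a(2) that by (intro sum_mono)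
    finally show ?thesis by (simp add: sum_divide_distrib)
  qed
  thus ?thesis using that[of "\<Sum>j\<in>UNIV. a j"] a(1) by (simp add: sum_nonneg)
qed

theorem theorem3p5:
  fixes Y :: "(real ^ 'n) set"
    and K :: "real ^ 'n \<Rightarrow> real ^ 'n \<Rightarrow> complex"
    and s1 \<beta> t1 t2 t3 :: real
  assumes "CARD('n) \<ge> 2"
    and "compact Y" and "C1_submanifold (CARD('n) - 1) Y"
    and "0 \<le> s1" and "s1 < real CARD('n) - 1"
    and "0 < \<beta>" and "\<beta> \<le> 1"
    and "\<beta> \<le> t1" and "t1 < (real CARD('n) - 1) + \<beta>"
    and "\<beta> \<le> t2"
    and "0 < t3" and "t3 \<le> 1"
    and "K \<in> kernel_class s1 (s1 + 1) 1 Y"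
    and "\<And>y. y \<in> Y \<Longrightarrow> C1_on_manifold (Y - {y}) (\<lambda>x. K x y)"
    and "t1 = real CARD('n) - 1"
    and "\<And>j. (\<lambda>x y. tangential_gradient Y (\<lambda>z. K z y) x $ j) \<in> kernel_class t1 t2 t3 Y"
    and "t2 - \<beta> > real CARD('n) - 1"
    and "t2 \<le> (real CARD('n) - 1) + t3"
    and "linear_continuous_map Y
           (holder_space \<beta> Y) (holder_norm \<beta> Y)
           (schauder_space \<beta> Y) (schauder_norm \<beta> Y)
           (integral_operator Y K)"
  shows "(SUP x\<in>Y. SUP r\<in>{0<..}.
            ennreal (norm (LINT y:(Y - ball x r)|surface_measure Y.
              tangential_gradient Y (\<lambda>z. K z y) x))) < \<infinity>"
proof -
  note \<beta> = assms(6,7) and T = assms(19)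
  define m where "m = CARD('n) - 1"
  have m: "1 \<le> m" "real m = real CARD('n) - 1" using assms(1) by (auto simp: m_def)
  define G where "G x y = tangential_gradient Y (\<lambda>z. K z y) x" for x y
  have GK: "\<And>j. (\<lambda>x y. G x y $ j) \<in> kernel_class (real m) t2 t3 Y"
    using assms(16) unfolding G_def assms(15) m(2) .
  have submf: "C1_submanifold m Y" using assms(3) by (simp add: m_def)
  obtain \<rho> C c where \<rho>: "0 < \<rho>" "0 \<le> C" "0 \<le> c"
    and C: "\<And>x r. x \<in> Y \<Longrightarrow> 0 < r \<Longrightarrow> r \<le> \<rho> \<Longrightarrow> hausdorff_outer m (Y \<inter> ball x r) \<le> ennreal (C * r ^ m)"
    and c: "\<And>x r. x \<in> Y \<Longrightarrow> 0 < r \<Longrightarrow> r \<le> \<rho> \<Longrightarrow> \<exists>y\<in>Y. 4 * r \<le> dist x y \<and> dist x y \<le> c * r"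
    by (rule submanifold_regular[OF submf assms(2) m(1)]) (rule that)
  let ?M = "surface_measure Y" and ?T = "integral_operator Y K"
  have finite: "finite_measure ?M"
    by (rule finite_surface_measure[OF assms(2) \<rho>(1) C[unfolded m_def]])
  interpret M: finite_measure ?M by (rule finite)
  obtain A0 where A0: "0 \<le> A0" "\<And>x y. x \<in> Y \<Longrightarrow> y \<in> Y \<Longrightarrow> x \<noteq> y \<Longrightarrow> norm (K x y) \<le> A0 / dist x y powr s1"
    by (rule kernel_class_bound[OF assms(13)]) (rule that)
  obtain A where A: "0 \<le> A" and A': "\<And>x y. x \<in> Y \<Longrightarrow> y \<in> Y \<Longrightarrow> x \<noteq> y \<Longrightarrow> norm (G x y) \<le> A / dist x y powr real m"
    by (rule kernel_class_vec_bound[OF GK]) (rule that)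
  have AG: "norm (G x y) \<le> A / dist x y ^ m" if "x \<in> Y" "y \<in> Y" "x \<noteq> y" for x y
    using A'[OF that] that by (simp add: powr_realpow)
  interpret gradient_kernel Y K G m
  proof
    show "\<exists>B. \<forall>x\<in>Y. \<forall>y\<in>Y. \<epsilon> \<le> dist x y \<longrightarrow> norm (K x y) \<le> B" if "0 < \<epsilon>" for \<epsilon>
      by (rule kernel_class_bound_off_diagonal[OF A0 assms(4) that])
    show "\<exists>B. \<forall>x\<in>Y. \<forall>y\<in>Y. \<epsilon> \<le> dist x y \<longrightarrow> norm (G x y) \<le> B" if "0 < \<epsilon>" for \<epsilon>
      by (rule kernel_class_bound_off_diagonal[OF A A' _ that]) (assumption | simp)+
    show "continuous_on (Y - {x}) (K x)" if "x \<in> Y" for x by (rule kernel_class_continuous[OF assms(13) that])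
    show "continuous_on (Y - {x}) (G x)" if "x \<in> Y" for x
    proof -
      have "continuous_on (Y - {x}) (\<lambda>y. \<chi> j. G x y $ j)"
        by (intro continuous_on_vec_lambda kernel_class_continuous[OF GK that])
      thus ?thesis by simp
    qed
    show "has_tangential_gradient (\<lambda>z. K z y) (G x y) Y x" if "x \<in> Y" "y \<in> Y" "x \<noteq> y" for x y
      unfolding G_def by (rule C1_on_manifold_has_tangential_gradient[OF submf assms(14)]) (use that in auto)
  qed (rule assms(2) submf finite)+
  have measure_ball: "measure ?M (Y \<inter> ball x r) \<le> C * r ^ m" if "x \<in> Y" "0 < r" "r \<le> \<rho>" for x r
  proof -
    have "emeasure ?M (Y \<inter> ball x r) = hausdorff_outer m (Y \<inter> ball x r)"
      unfolding m_def using borel by (intro emeasure_surface_measure) auto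
    also have "\<dots> \<le> ennreal (C * r ^ m)" by (rule C[OF that])
    finally have "ennreal (measure ?M (Y \<inter> ball x r)) \<le> ennreal (C * r ^ m)"
      unfolding M.emeasure_eq_measure .
    thus ?thesis using \<rho>(2) that(2) by (subst (asm) ennreal_le_iff) auto
  qed
  have sets_ball: "Y \<inter> ball x r \<in> sets ?M" for x r
    by (auto simp: sets_surface_measure sets_restrict_space)
  have schauder: "?T \<mu> \<in> schauder_space \<beta> Y" if "\<mu> \<in> holder_space \<beta> Y" for \<mu>
    by (rule bspec[OF conjunct1[OF T[unfolded linear_continuous_map_def]] that])
  have linear: "?T (\<lambda>y. a * \<mu> y + b * \<nu> y) x = a * ?T \<mu> x + b * ?T \<nu> x"
    if "\<mu> \<in> holder_space \<beta> Y" "\<nu> \<in> holder_space \<beta> Y" "x \<in> Y" for \<mu> \<nu> a b x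
    using conjunct1[OF conjunct2[OF T[unfolded linear_continuous_map_def]]] that by simp
  have grad: "has_tangential_gradient (?T \<mu>) (tangential_gradient Y (?T \<mu>) x) Y x"
    if "\<mu> \<in> holder_space \<beta> Y" "x \<in> Y" for \<mu> x
    by (rule C1_on_manifold_has_tangential_gradient[OF submf, of "{}"])
       (use schauder[OF that(1)] that(2) in \<open>auto simp: schauder_space_def\<close>)
  have const: "(\<lambda>_. a) \<in> holder_space \<beta> Y" for a :: complex
    unfolding holder_space_def mem_Collect_eq
    by (rule le_less_trans[OF holder_norm_le[of _ _ "norm a" 0]]) auto
  obtain \<delta> where \<delta>: "0 < \<delta>" "\<And>\<nu>. \<nu> \<in> holder_space \<beta> Y \<Longrightarrow> holder_norm \<beta> Y \<nu> < ennreal \<delta> \<Longrightarrow> schauder_norm \<beta> Y (?T \<nu>) < 1"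
  proof (rule linear_continuous_map_bounded_at_0[OF T const])
    show "?T (\<lambda>_. 0) x = 0" for x by (simp add: integral_operator_def)
  qed (rule that)
  \<comment> \<open>The scaled cutoff will have sup norm and Hoelder constant at most
    \<open>\<epsilon>\<close> each, and \<open>2 * \<epsilon> < \<delta>\<close>;
    \<open>\<epsilon> \<le> 1\<close> keeps its values in the range required for
    integrability.\<close>
  define \<epsilon> where "\<epsilon> = min 1 (\<delta> / 4)"
  have \<epsilon>: "0 < \<epsilon>" "\<epsilon> \<le> 1" "2 * \<epsilon> < \<delta>" using \<delta>(1) by (auto simp: \<epsilon>_def)
  define H where "H = enn2real (holder_norm \<beta> Y (tangential_gradient Y (?T (\<lambda>_. 1))))"
  have H: "norm (tangential_gradient Y (?T (\<lambda>_. 1)) x) \<le> H" if "x \<in> Y" for x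
  proof (rule holder_norm_bounds(1)[OF _ _ that])
    have "holder_norm \<beta> Y (tangential_gradient Y (?T (\<lambda>_. 1))) < top"
      using schauder[OF const[of 1]] by (simp add: schauder_space_def holder_space_def)
    thus "holder_norm \<beta> Y (tangential_gradient Y (?T (\<lambda>_. 1))) \<le> ennreal H" by (simp add: H_def)
  qed (simp add: H_def)
  \<comment> \<open>The cutoff lives on a ball of radius \<open>2 * r\<close>, whose measure is
    controlled up to \<open>\<rho>\<close>; \<open>r \<le> 1\<close> gives
    \<open>r powr \<beta> \<le> 1\<close>.\<close>
  define r0 where "r0 = min (\<rho> / 2) 1"
  have r0: "0 < r0" "2 * r0 \<le> \<rho>" "r0 \<le> 1" using \<rho> by (auto simp: r0_def)
  \<comment> \<open>Bound at \<open>x\<close> for the gradient of the image of the unscaled cutoff: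
    \<open>A * C\<close> comes from the remote point, \<open>c powr \<beta> / \<epsilon>\<close>
    from the passage to \<open>x\<close>.\<close>
  define Q where "Q = A * C + c powr \<beta> / \<epsilon>"
  have int_eq: "(LINT y:(Y - ball x r)|?M. G x y) = (\<integral>y. indicator (- ball x r) y *\<^sub>R G x y \<partial>?M)" for x r
    unfolding set_lebesgue_integral_def
    by (rule Bochner_Integration.integral_cong) (auto simp: indicator_def)
  have small: "norm (LINT y:(Y - ball x r)|?M. G x y) \<le> H + Q + 2 ^ m * (A * C)"
    if x: "x \<in> Y" and r: "0 < r" "r \<le> r0" for x r
  proof -
    have r': "2 * r \<le> \<rho>" "r \<le> \<rho>" "r \<le> 1" using r r0 by auto
    \<comment> \<open>This factor turns the Hoelder constant \<open>1 / r powr \<beta>\<close> of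
      the cutoff into \<open>\<epsilon>\<close>.\<close>
    define k where "k = \<epsilon> * r powr \<beta>"
    have "r powr \<beta> \<le> 1" using r r' \<beta> by (intro powr_le1) auto
    hence "k \<le> \<epsilon>" using \<epsilon>(1) by (simp add: k_def mult_left_le)
    moreover have "0 < k" using \<epsilon>(1) r(1) by (simp add: k_def)
    ultimately have k: "0 < k" "k \<le> \<epsilon>" "k \<le> 1" using \<epsilon>(2) by auto
    define \<nu> where "\<nu> = (\<lambda>y. k * bump x r y)"
    have \<nu>_meas: "\<nu> \<in> borel_measurable borel" unfolding \<nu>_def by measurable
    have \<nu>_le: "\<bar>\<nu> y\<bar> \<le> k" for y
      using k bump_nonneg[of x r y] bump_le_1[of x r y] by (simp add: \<nu>_def abs_mult mult_left_le)
    have \<nu>_eq_0: "\<nu> y = 0" if "2 * r \<le> dist x y" for y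
      using bump_eq_0[OF r(1) that] by (simp add: \<nu>_def)
    note \<nu> = \<nu>_meas \<nu>_le \<nu>_eq_0
    have \<nu>_norm: "holder_norm \<beta> Y (\<lambda>y. complex_of_real (\<nu> y)) \<le> ennreal (k + \<epsilon>)"
    proof (rule holder_norm_le)
      fix y z
      have "norm (complex_of_real (\<nu> y) - complex_of_real (\<nu> z)) = k * \<bar>bump x r y - bump x r z\<bar>"
        unfolding of_real_diff[symmetric] norm_of_real \<nu>_def right_diff_distrib[symmetric] abs_mult
        using k(1) by simp
      also have "\<dots> \<le> k * ((1 / r powr \<beta>) * dist y z powr \<beta>)"
        using k by (intro mult_left_mono bump_holder r \<beta>) auto
      finally show "norm (complex_of_real (\<nu> y) - complex_of_real (\<nu> z)) \<le> \<epsilon> * dist y z powr \<beta>"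
        using r by (simp add: k_def)
    qed (use \<nu>_le k(1) \<epsilon>(1) in simp_all)
    have \<nu>_space: "(\<lambda>y. complex_of_real (\<nu> y)) \<in> holder_space \<beta> Y"
      unfolding holder_space_def using \<nu>_norm by (auto intro: le_less_trans)
    let ?g = "tangential_gradient Y (?T (\<lambda>y. complex_of_real (\<nu> y)))"
    have "ennreal (k + \<epsilon>) < ennreal \<delta>" using k \<epsilon> by (intro ennreal_lessI) auto
    hence "schauder_norm \<beta> Y (?T (\<lambda>y. complex_of_real (\<nu> y))) < 1"
      using \<nu>_norm by (intro \<delta>(2) \<nu>_space) auto
    moreover have "holder_norm \<beta> Y ?g \<le> schauder_norm \<beta> Y (?T (\<lambda>y. complex_of_real (\<nu> y)))"
      unfolding schauder_norm_def by simp
    ultimately have g_holder: "holder_norm \<beta> Y ?g \<le> ennreal 1" by auto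
    obtain z where z: "z \<in> Y" "4 * r \<le> dist x z" "dist x z \<le> c * r" using c[OF x r(1) r'(2)] by blast
    have gz: "norm (?g z) \<le> k * (A * C)"
    proof -
      \<comment> \<open>As \<open>z\<close> is at least \<open>4 * r\<close> from \<open>x\<close>,
        the ball of radius \<open>2 * r\<close> around \<open>z\<close> misses the support of
        \<open>\<nu>\<close>.\<close>
      have van: "\<nu> y = 0" if "dist z y < 2 * r" for y
        using that z(2) dist_triangle[of x z y] by (intro \<nu>(3)) (simp add: dist_commute)
      have "?g z = (\<integral>y. \<nu> y *\<^sub>R G z y \<partial>?M)"
      proof (rule gradient_integral[OF \<nu>(1) _ van _ z(1)])
        show "\<bar>\<nu> y\<bar> \<le> 1" for y using \<nu>(2)[of y] k by linarith
        show "has_tangential_gradient (\<lambda>x. \<integral>y. \<nu> y *\<^sub>R K x y \<partial>?M) (?g z) Y z"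
          using grad[OF \<nu>_space z(1)] unfolding integral_operator_of_real .
      qed (use r in auto)
      also have "norm \<dots> \<le> k * (A / (2 * r) ^ m) * measure ?M (Y \<inter> ball x (2 * r))"
        by (rule norm_integral_G_le[OF z(1) \<nu>(1,2) van _ k(3) A AG[OF z(1)] sets_ball])
           (use r \<nu>(3) in auto)
      also have "\<dots> \<le> k * (A / (2 * r) ^ m) * (C * (2 * r) ^ m)"
        using measure_ball[OF x, of "2 * r"] r r' k A by (intro mult_left_mono mult_nonneg_nonneg) auto
      \<comment> \<open>The critical order: \<open>(2 * r) ^ m\<close> from the kernel cancels
        against the measure of the ball.\<close>
      also have "\<dots> = k * (A * C)" using r by simp
      finally show ?thesis .
    qed
    have "norm (?g x - ?g z) \<le> dist x z powr \<beta>"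
      using holder_norm_bounds(2)[OF g_holder _ x z(1)] by simp
    also have "\<dots> \<le> (c * r) powr \<beta>" using z \<beta> by (intro powr_mono2) auto
    \<comment> \<open>The powers of \<open>r\<close> cancel: \<open>r powr \<beta>\<close> equals
      \<open>k / \<epsilon>\<close>, so both parts of the bound at \<open>x\<close> are proportional
      to \<open>k\<close>.\<close>
    also have "\<dots> = k * (c powr \<beta> / \<epsilon>)" using r \<rho> \<epsilon> by (simp add: powr_mult k_def)
    finally have gx: "norm (?g x) \<le> k * Q"
      using gz norm_triangle_sub[of "?g x" "?g z"] by (simp add: Q_def distrib_left)
    \<comment> \<open>\<open>h\<close> vanishes near \<open>x\<close>, so its gradient at
      \<open>x\<close> is an integral of \<open>G\<close>; on the other hand it is
      \<open>1 - \<nu> / k\<close>, whose gradient is bounded by linearity.\<close>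
    define h where "h = (\<lambda>y. 1 - bump x r y)"
    have h_meas: "h \<in> borel_measurable borel" unfolding h_def by measurable
    have h_le: "\<bar>h y\<bar> \<le> 1" for y
      using bump_nonneg[of x r y] bump_le_1[of x r y] by (simp add: h_def)
    have h_eq_0: "h y = 0" if "dist x y < r" for y
      using bump_eq_1[OF r(1), of x y] that by (simp add: h_def)
    note h = h_meas h_le h_eq_0
    have h_eq: "complex_of_real (h y) = 1 * 1 + complex_of_real (- (1 / k)) * complex_of_real (\<nu> y)" for y
      using k by (simp add: h_def \<nu>_def)
    have Th: "?T (\<lambda>y. complex_of_real (h y)) z = of_real 1 * ?T (\<lambda>_. 1) z + of_real (- (1 / k)) * ?T (\<lambda>y. complex_of_real (\<nu> y)) z"
      if "z \<in> Y" for z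
      unfolding h_eq of_real_1
      using linear[OF const[of 1] \<nu>_space that, of 1 "complex_of_real (- (1 / k))"] by simp
    have "has_tangential_gradient (?T (\<lambda>y. complex_of_real (h y)))
        (1 *\<^sub>R tangential_gradient Y (?T (\<lambda>_. 1)) x + (- (1 / k)) *\<^sub>R ?g x) Y x"
      by (rule has_tangential_gradient_lincomb[OF subspace_tangent_space[OF submf x] x
            grad[OF const x] grad[OF \<nu>_space x] Th])
    hence "1 *\<^sub>R tangential_gradient Y (?T (\<lambda>_. 1)) x + (- (1 / k)) *\<^sub>R ?g x = (\<integral>y. h y *\<^sub>R G x y \<partial>?M)"
      unfolding ext[of "?T (\<lambda>y. complex_of_real (h y))", OF integral_operator_of_real]
      by (intro gradient_integral[OF h r(1) x])
    moreover have "norm (1 *\<^sub>R tangential_gradient Y (?T (\<lambda>_. 1)) x + (- (1 / k)) *\<^sub>R ?g x) \<le> H + Q"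
    proof -
      have "norm ((- (1 / k)) *\<^sub>R ?g x) = norm (?g x) / k" using k(1) by simp
      also have "\<dots> \<le> Q" using gx k(1) by (simp only: divide_le_eq mult.commute[of Q] if_True)
      finally show ?thesis using H[OF x] by (intro order_trans[OF norm_triangle_ineq] add_mono) simp_all
    qed
    ultimately have hG: "norm (\<integral>y. h y *\<^sub>R G x y \<partial>?M) \<le> H + Q" by simp
    define i where "i = (indicator (- ball x r) :: real ^ 'n \<Rightarrow> real)"
    have i_meas: "i \<in> borel_measurable borel" unfolding i_def by measurable
    have i_le: "\<bar>i y\<bar> \<le> 1" for y by (simp add: i_def indicator_def)
    have i_eq_0: "i y = 0" if "dist x y < r" for y using that by (simp add: i_def)
    note i = i_meas i_le i_eq_0
    \<comment> \<open>The sharp and the smooth truncation differ only for distances between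
      \<open>r\<close> and \<open>2 * r\<close>; there the kernel is at most
      \<open>A / r ^ m\<close>, and the doubled radius costs the factor
      \<open>2 ^ m\<close>.\<close>
    have "norm (\<integral>y. (i y - h y) *\<^sub>R G x y \<partial>?M) \<le> 1 * (A / r ^ m) * measure ?M (Y \<inter> ball x (2 * r))"
    proof (rule norm_integral_G_le[OF x _ _ _ r(1) _ A AG[OF x] sets_ball])
      show "(\<lambda>y. i y - h y) \<in> borel_measurable borel" using i(1) h(1) by measurable
      show "\<bar>i y - h y\<bar> \<le> 1" for y
        using bump_nonneg[of x r y] bump_le_1[of x r y] by (auto simp: i_def h_def indicator_def)
      show "i y - h y = 0" if "dist x y < r" for y using that i h by simp
      show "i y - h y = 0" if "y \<in> Y" "y \<notin> Y \<inter> ball x (2 * r)" for y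
        using that r by (auto simp: i_def h_def indicator_def bump_eq_0)
    qed simp_all
    also have "\<dots> \<le> 1 * (A / r ^ m) * (C * (2 * r) ^ m)"
      using measure_ball[OF x, of "2 * r"] r r' A by (intro mult_left_mono) auto
    also have "\<dots> = 2 ^ m * (A * C)" using r by (simp add: power_mult_distrib)
    finally have "norm (\<integral>y. (i y - h y) *\<^sub>R G x y \<partial>?M) \<le> 2 ^ m * (A * C)" .
    moreover have "(\<integral>y. (i y - h y) *\<^sub>R G x y \<partial>?M) = (\<integral>y. i y *\<^sub>R G x y \<partial>?M) - (\<integral>y. h y *\<^sub>R G x y \<partial>?M)"
      unfolding scaleR_diff_left
      by (intro Bochner_Integration.integral_diff G_integrable[OF x i r(1)] G_integrable[OF x h r(1)])
    ultimately show ?thesis unfolding int_eq i_def[symmetric]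
      using hG norm_triangle_sub[of "\<integral>y. i y *\<^sub>R G x y \<partial>?M" "\<integral>y. h y *\<^sub>R G x y \<partial>?M"] by simp
  qed
  \<comment> \<open>Beyond \<open>r0\<close> the kernel is bounded and the total measure is finite,
    so no cancellation is involved.\<close>
  have large: "norm (LINT y:(Y - ball x r)|?M. G x y) \<le> A / r0 ^ m * measure ?M Y"
    if x: "x \<in> Y" and r: "r0 \<le> r" for x r
  proof -
    have "norm (\<integral>y. indicator (- ball x r) y *\<^sub>R G x y \<partial>?M) \<le> 1 * (A / r0 ^ m) * measure ?M Y"
    proof (rule norm_integral_G_le[OF x _ _ _ r0(1) _ A AG[OF x]])
      show "(indicator (- ball x r) :: real ^ 'n \<Rightarrow> real) \<in> borel_measurable borel" by measurable
      show "\<bar>indicator (- ball x r) y :: real\<bar> \<le> 1" for y by (simp add: indicator_def)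
      show "(indicator (- ball x r) y :: real) = 0" if "dist x y < r0" for y using that r by simp
      show "Y \<in> sets ?M" using sets.top[of ?M] by simp
    qed simp_all
    thus ?thesis by (simp add: int_eq)
  qed
  define B where "B = max (H + Q + 2 ^ m * (A * C)) (A / r0 ^ m * measure ?M Y)"
  have "norm (LINT y:(Y - ball x r)|?M. G x y) \<le> B" if "x \<in> Y" "0 < r" for x r
    using small[OF that(1), of r] large[OF that(1), of r] that(2) by (cases "r \<le> r0") (auto simp: B_def)
  hence "(SUP x\<in>Y. SUP r\<in>{0<..}. ennreal (norm (LINT y:(Y - ball x r)|?M. G x y))) \<le> ennreal B"
    by (intro SUP_least ennreal_leI) auto
  thus ?thesis unfolding G_def by (rule le_less_trans) simp
qed

end
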